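(* If $X$ is a Calabi-Yau manifold, then every surjective holomorphic self-map $f:X\rightarrow X$ is biholomorphic.
   Context: A Calabi-Yau manifold here means a compact complex manifold $X$ (connected) with finite fundamental group and with $K_X^{\otimes m}=\mathcal{O}_X$ (i.e. $K_X^{\otimes m}$ is holomorphically trivial) for some positive integer $m$, where $K_X$ is the canonical bundle. $X$ is not assumed to be Kähler. *)

theory Defs
  imports "HOL-Analysis.Analysis" "HOL-Algebra.Group"
begin

section \<open>Holomorphic functions and maps on open subsets of complex coordinate space\<close>

text \<open>
  The derivative in the library is the real one; complex differentiability is
  real differentiability with a complex-linear derivative. The sets below are always open.
\<close>

definition holo_fun_on :: "(complex^'n \<Rightarrow> complex) \<Rightarrow> (complex^'n) set \<Rightarrow> bool" where
  "holo_fun_on g U \<longleftrightarrow>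
     (\<forall>x\<in>U. \<exists>D. (g has_derivative D) (at x) \<and> (\<forall>c v. D (c *s v) = c * D v))"

definition holo_map_on :: "(complex^'n \<Rightarrow> complex^'m) \<Rightarrow> (complex^'n) set \<Rightarrow> bool" where
  "holo_map_on g U \<longleftrightarrow>
     (\<forall>x\<in>U. \<exists>D. (g has_derivative D) (at x) \<and> (\<forall>c v. D (c *s v) = c *s D v))"


section \<open>Complex manifolds\<close>

text \<open>
  The underlying space is a whole type, Hausdorff and second countable by its sort. A chart is
  a pair of its domain and a total function, whose values outside the domain are irrelevant.
  The complex structure is given by an atlas, not required to be maximal.
\<close>

type_synonym ('a, 'n) chart = "'a set \<times> ('a \<Rightarrow> complex^'n)"

definition chart_inv :: "('a, 'n::finite) chart \<Rightarrow> complex^'n \<Rightarrow> 'a" where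
  "chart_inv a = inv_into (fst a) (snd a)"

definition complex_atlas ::
    "('a::{t2_space, second_countable_topology}, 'n::finite) chart set \<Rightarrow> bool" where
  "complex_atlas A \<longleftrightarrow>
     (\<Union>(U, \<phi>)\<in>A. U) = UNIV \<and>
     (\<forall>(U, \<phi>)\<in>A. open U \<and> open (\<phi> ` U) \<and> homeomorphism U (\<phi> ` U) \<phi> (chart_inv (U, \<phi>))) \<and>
     (\<forall>(U, \<phi>)\<in>A. \<forall>(V, \<psi>)\<in>A. holo_map_on (\<psi> \<circ> chart_inv (U, \<phi>)) (\<phi> ` (U \<inter> V)))"

definition holomorphic_function_on ::
    "('a::topological_space, 'n::finite) chart set \<Rightarrow> ('a \<Rightarrow> complex) \<Rightarrow> 'a set \<Rightarrow> bool" where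
  "holomorphic_function_on A h W \<longleftrightarrow>
     (\<forall>(U, \<phi>)\<in>A. holo_fun_on (h \<circ> chart_inv (U, \<phi>)) (\<phi> ` (U \<inter> W)))"

definition holomorphic_map ::
    "('a::topological_space, 'n::finite) chart set \<Rightarrow> ('b::topological_space, 'm::finite) chart set \<Rightarrow>
     ('a \<Rightarrow> 'b) \<Rightarrow> bool" where
  "holomorphic_map A B f \<longleftrightarrow>
     continuous_on UNIV f \<and>
     (\<forall>(U, \<phi>)\<in>A. \<forall>(V, \<psi>)\<in>B.
        holo_map_on (\<psi> \<circ> f \<circ> chart_inv (U, \<phi>)) (\<phi> ` (U \<inter> f -` V)))"

definition biholomorphic_map ::
    "('a::topological_space, 'n::finite) chart set \<Rightarrow> ('b::topological_space, 'm::finite) chart set \<Rightarrow>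
     ('a \<Rightarrow> 'b) \<Rightarrow> bool" where
  "biholomorphic_map A B f \<longleftrightarrow>
     bij f \<and> holomorphic_map A B f \<and> holomorphic_map B A (inv_into UNIV f)"


section \<open>Line bundles and the canonical bundle\<close>

text \<open>
  A holomorphic line bundle that is trivialised over every chart domain is given by its
  transition functions: \<open>g a b p\<close> takes the fibre coordinate over the chart \<open>b\<close> to the one over
  the chart \<open>a\<close>, for \<open>p\<close> in both domains. Values elsewhere are irrelevant.
\<close>

type_synonym ('a, 'n) transitions = "('a, 'n) chart \<Rightarrow> ('a, 'n) chart \<Rightarrow> 'a \<Rightarrow> complex"

text \<open>
  Over the chart \<open>(U, \<phi>)\<close> with coordinates \<open>z\<close> the bundle of holomorphic forms of top degree has
  the frame \<open>dz\<^sub>1 \<and> \<dots> \<and> dz\<^sub>n\<close>. If \<open>w\<close> are the coordinates of \<open>(V, \<psi>)\<close>, then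
  \<open>dw\<^sub>1 \<and> \<dots> \<and> dw\<^sub>n = det (\<partial>w / \<partial>z) dz\<^sub>1 \<and> \<dots> \<and> dz\<^sub>n\<close>.
\<close>

definition canonical_bundle :: "('a::topological_space, 'n::finite) transitions" where
  "canonical_bundle a b p = det (jacobian (snd b \<circ> chart_inv a) (at (snd a p)))"

definition tensor_power :: "('a, 'n::finite) transitions \<Rightarrow> nat \<Rightarrow> ('a, 'n) transitions" where
  "tensor_power g m a b p = g a b p ^ m"

definition trivial_bundle :: "('a, 'n::finite) transitions" where
  "trivial_bundle a b p = 1"

lemma canonical_bundle_cocycle:
  assumes A: "complex_atlas A" and abc: "a \<in> A" "b \<in> A" "c \<in> A"
    and p: "p \<in> fst a \<inter> fst b \<inter> fst c"
  shows "canonical_bundle a b p * canonical_bundle b c p = canonical_bundle a c p"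
    and "canonical_bundle a a p = 1"
proof -
  have inv: "chart_inv d (snd d q) = q" if "d \<in> A" "q \<in> fst d" for d q
    using A that by (cases d) (fastforce simp: complex_atlas_def homeomorphism_def)
  have op: "open (snd d ` (fst d \<inter> fst e))" if "d \<in> A" "e \<in> A" for d e
  proof -
    have "homeomorphism (fst d) (snd d ` fst d) (snd d) (chart_inv d)" "open (snd d ` fst d)" "open (fst e)"
      using A that by (cases d, cases e, auto simp: complex_atlas_def)+
    moreover have "openin (top_of_set (fst d)) (fst d \<inter> fst e)" using \<open>open (fst e)\<close> by (simp add: openin_open_Int)
    ultimately show ?thesis
      using homeomorphism_imp_open_map openin_open_trans by blast
  qed
  have D: "\<exists>D. (snd e \<circ> chart_inv d has_derivative D) (at (snd d p)) \<and> Vector_Spaces.linear (*s) (*s) D"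
    if "d \<in> A" "e \<in> A" "p \<in> fst d" "p \<in> fst e" for d e
  proof -
    have "holo_map_on (snd e \<circ> chart_inv d) (snd d ` (fst d \<inter> fst e))"
      using A that by (cases d, cases e) (auto simp: complex_atlas_def)
    moreover have "snd d p \<in> snd d ` (fst d \<inter> fst e)" using that by simp
    ultimately obtain D where D: "(snd e \<circ> chart_inv d has_derivative D) (at (snd d p))"
      "\<forall>c v. D (c *s v) = c *s D v" unfolding holo_map_on_def by (elim ballE exE) auto
    interpret b: bounded_linear D by (rule has_derivative_bounded_linear[OF D(1)])
    have "Vector_Spaces.linear (*s) (*s) D"
      unfolding Vector_Spaces.linear_iff using D(2) b.add vec.vector_space_axioms by simp
    with D show ?thesis by blast
  qed
  obtain D1 where D1: "(snd b \<circ> chart_inv a has_derivative D1) (at (snd a p))" "Vector_Spaces.linear (*s) (*s) D1"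
    using D abc p by blast
  obtain D2 where D2: "(snd c \<circ> chart_inv b has_derivative D2) (at (snd b p))" "Vector_Spaces.linear (*s) (*s) D2"
    using D abc p by blast
  have "((snd c \<circ> chart_inv b) \<circ> (snd b \<circ> chart_inv a) has_derivative D2 \<circ> D1) (at (snd a p))"
    using D1(1) D2(1) inv[of a p] abc p by (intro diff_chain_at) auto
  moreover have "((snd c \<circ> chart_inv b) \<circ> (snd b \<circ> chart_inv a)) z = (snd c \<circ> chart_inv a) z"
    if "z \<in> snd a ` (fst a \<inter> fst b)" for z
    using that abc by (elim imageE) (simp add: inv)
  ultimately have D3: "(snd c \<circ> chart_inv a has_derivative D2 \<circ> D1) (at (snd a p))"
    using has_derivative_transform_within_open[OF _ op[OF abc(1,2)]] p by blast
  have 1: "canonical_bundle a b p = det (matrix D1)" "canonical_bundle b c p = det (matrix D2)"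
    "canonical_bundle a c p = det (matrix (D2 \<circ> D1))"
    by (simp_all add: canonical_bundle_def jacobian_def frechet_derivative_at[OF D1(1), symmetric] frechet_derivative_at[OF D2(1), symmetric] frechet_derivative_at[OF D3, symmetric])
  show "canonical_bundle a b p * canonical_bundle b c p = canonical_bundle a c p"
    unfolding 1 matrix_compose_gen[OF D1(2) D2(2)] det_mul by simp
  have "(snd a \<circ> chart_inv a has_derivative id) (at (snd a p))"
    using has_derivative_transform_within_open[OF has_derivative_id op[OF abc(1,1)], of "snd a p" "snd a \<circ> chart_inv a"]
      p abc by (fastforce simp: inv id_def)
  then have "canonical_bundle a a p = det (matrix id :: complex^'b^'b)"
    by (simp only: canonical_bundle_def jacobian_def frechet_derivative_at[symmetric])
  also have "matrix id = (mat 1 :: complex^'b^'b)" by (simp add: matrix_def mat_def axis_def id_def vec_eq_iff)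
  finally show "canonical_bundle a a p = 1" by simp
qed

text \<open>
  An isomorphism multiplies the fibre coordinate over the chart \<open>a\<close> by a nowhere
  vanishing holomorphic function \<open>s a\<close>, compatibly with the transition functions.
\<close>

definition bundle_isomorphic ::
    "('a::topological_space, 'n::finite) chart set \<Rightarrow> ('a, 'n) transitions \<Rightarrow>
     ('a, 'n) transitions \<Rightarrow> bool" where
  "bundle_isomorphic A g h \<longleftrightarrow>
     (\<exists>s. (\<forall>a\<in>A. holomorphic_function_on A (s a) (fst a) \<and> (\<forall>p\<in>fst a. s a p \<noteq> 0)) \<and>
          (\<forall>a\<in>A. \<forall>b\<in>A. \<forall>p\<in>fst a \<inter> fst b. s a p * g a b p = h a b p * s b p))"


section \<open>The fundamental group\<close>

definition loops_at :: "'a::topological_space \<Rightarrow> (real \<Rightarrow> 'a) set" where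
  "loops_at x = {p. path p \<and> pathstart p = x \<and> pathfinish p = x}"

definition loop_class :: "(real \<Rightarrow> 'a::topological_space) \<Rightarrow> (real \<Rightarrow> 'a) set" where
  "loop_class p = {q. homotopic_paths UNIV p q}"

definition fundamental_group :: "'a::topological_space \<Rightarrow> (real \<Rightarrow> 'a) set monoid" where
  "fundamental_group x =
     \<lparr>carrier = loop_class ` loops_at x,
      mult = (\<lambda>P Q. \<Union>p\<in>P. \<Union>q\<in>Q. loop_class (p +++ q)),
      one = loop_class (\<lambda>_. x)\<rparr>"

lemma half_unique: "1 \<le> 2*t \<Longrightarrow> t*2 \<le> 1 \<Longrightarrow> t = 1/2" for t::real by simp

lemma loop_class_eq: "homotopic_paths UNIV p q \<Longrightarrow> loop_class p = loop_class q"
  unfolding loop_class_def using homotopic_paths_trans homotopic_paths_sym by blast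

lemma loop_class_mult:
  assumes "p \<in> loops_at x" "q \<in> loops_at x"
  shows "loop_class p \<otimes>\<^bsub>fundamental_group x\<^esub> loop_class q = loop_class (p +++ q)"
proof -
  have eq: "loop_class (p' +++ q') = loop_class (p +++ q)"
    if "p' \<in> loop_class p" "q' \<in> loop_class q" for p' q'
    using loop_class_eq[OF homotopic_paths_join, of p p' q q'] that assms
    by (simp add: loops_at_def loop_class_def)
  have "p \<in> loop_class p" "q \<in> loop_class q"
    using assms by (auto simp: loop_class_def loops_at_def)
  then show ?thesis
    unfolding fundamental_group_def monoid.simps using eq by blast
qed

lemma loop_const_lid:
  assumes "p \<in> loops_at x"
  shows "homotopic_paths UNIV ((\<lambda>_. x) +++ p) p"
proof (rule homotopic_paths_sym, rule homotopic_paths_reparametrize [where f = "\<lambda>t. max 0 (2*t - 1)"])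
  show "continuous_on {0..1} (\<lambda>t::real. max 0 (2*t-1))" by (intro continuous_intros)
qed (use assms in \<open>auto dest!: half_unique simp: pathstart_def pathfinish_def loops_at_def joinpaths_def max_def\<close>)

lemma loop_rinv:
  fixes p :: "real \<Rightarrow> 'a::topological_space"
  assumes "p \<in> loops_at x"
  shows "homotopic_paths UNIV (p +++ reversepath p) (\<lambda>_. x)"
proof (rule homotopic_paths_sym)
  have P: "continuous_on {0..1} p" and px: "p 0 = x" using assms by (auto simp: loops_at_def pathstart_def path_def)
  define h where "h = (\<lambda>y::real\<times>real. p (fst y * (1 - \<bar>2 * snd y - 1\<bar>)))"
  have "continuous_on ({0..1} \<times> {0..1}) h" unfolding h_def
    by (intro continuous_on_compose2 [OF P] continuous_intros) (auto simp: mult_le_one abs_if)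
  moreover have "h (1,t) = (p +++ reversepath p) t" for t
    by (cases "2 * t = 1") (auto simp: h_def joinpaths_def reversepath_def abs_if algebra_simps)
  ultimately show "homotopic_paths UNIV (\<lambda>_. x) (p +++ reversepath p)"
    unfolding homotopic_paths using px
    by (intro exI[of _ h]) (auto simp: h_def pathstart_def pathfinish_def joinpaths_def reversepath_def)
qed

lemma loops_at_join: "p \<in> loops_at x \<Longrightarrow> q \<in> loops_at x \<Longrightarrow> p +++ q \<in> loops_at x"
  by (auto simp: loops_at_def)

theorem group_fundamental_group: "group (fundamental_group x)"
proof -
  note loop_class_mult [simp]
  have c: "(\<lambda>_. x) \<in> loops_at x" by (simp add: loops_at_def path_def pathstart_def pathfinish_def)
  have car: "carrier (fundamental_group x) = loop_class ` loops_at x"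
    and one: "\<one>\<^bsub>fundamental_group x\<^esub> = loop_class (\<lambda>_. x)"
    by (auto simp: fundamental_group_def)
  show ?thesis
  proof (rule groupI; (unfold car one)?)
    fix P Q R assume "P \<in> loop_class ` loops_at x" "Q \<in> loop_class ` loops_at x" "R \<in> loop_class ` loops_at x"
    then obtain p q r where "p \<in> loops_at x" "q \<in> loops_at x" "r \<in> loops_at x"
      "P = loop_class p" "Q = loop_class q" "R = loop_class r" by auto
    moreover then have "loop_class ((p +++ q) +++ r) = loop_class (p +++ (q +++ r))"
      by (intro loop_class_eq homotopic_paths_sym[OF homotopic_paths_assoc]) (auto simp: loops_at_def)
    ultimately show "P \<otimes>\<^bsub>fundamental_group x\<^esub> Q \<otimes>\<^bsub>fundamental_group x\<^esub> R
      = P \<otimes>\<^bsub>fundamental_group x\<^esub> (Q \<otimes>\<^bsub>fundamental_group x\<^esub> R)"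
      by (simp add: loops_at_join)
  next
    fix P assume "P \<in> loop_class ` loops_at x"
    then obtain p where p: "p \<in> loops_at x" "P = loop_class p" by auto
    then have r: "reversepath p \<in> loops_at x" by (auto simp: loops_at_def)
    have "loop_class (reversepath p +++ p) = loop_class (\<lambda>_. x)"
      using loop_class_eq[OF loop_rinv[OF r]] by simp
    then show "\<exists>Q\<in>loop_class ` loops_at x. Q \<otimes>\<^bsub>fundamental_group x\<^esub> P = loop_class (\<lambda>_. x)"
      using p r by (intro bexI[of _ "loop_class (reversepath p)"]) simp_all
  qed (use c loop_class_eq[OF loop_const_lid[where x=x]] in \<open>auto simp: loops_at_join\<close>)
qed


section \<open>Calabi-Yau manifolds\<close>

definition calabi_yau ::
    "('a::{t2_space, second_countable_topology}, 'n::finite) chart set \<Rightarrow> bool" where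
  "calabi_yau A \<longleftrightarrow>
     complex_atlas A \<and>
     compact (UNIV :: 'a set) \<and>
     connected (UNIV :: 'a set) \<and>
     (\<forall>x::'a. finite (carrier (fundamental_group x))) \<and>
     (\<exists>m>0. bundle_isomorphic A (tensor_power canonical_bundle m) trivial_bundle)"

end

(*
  Let s be a nowhere vanishing section of the m-th power of the canonical bundle. Then the
  pullback of s under f is h s for a holomorphic function h, whose modulus is constant by the
  maximum principle. In charts h is the m-th power of the Jacobian determinant of f times a
  nowhere vanishing function. By Sard's theorem and surjectivity the determinant is nonzero
  somewhere, hence everywhere, so f is a local homeomorphism and, by compactness, a covering
  map. The map it induces on the fundamental group is injective. As the group is finite, it is
  also surjective, so the covering has one sheet.
*)
theory Submission
  imports Defs "HOL-Complex_Analysis.Conformal_Mappings"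
begin

text \<open>A surjective holomorphic self-map may branch, and the branch locus is where its Jacobian
  determinant vanishes. The determinant depends on the charts, but the quotient of two sections of
  the same line bundle is a function, and on a compact connected manifold a holomorphic function of
  constant modulus cannot vanish at some points only. So the triviality of a power of the canonical
  bundle excludes branching. It does not exclude unbranched self-coverings of higher degree, such as
  doubling on a complex torus; this is what finiteness of the fundamental group is for.

  The analytic obstacle is that holomorphy is given as complex differentiability at each point. That
  the derivative varies continuously, and the Jacobian determinant holomorphically, has to be won
  from Cauchy estimates before the inverse function theorem and the maximum principle can be
  applied.\<close>

section \<open>Coverings of a space with finite fundamental group by itself\<close>

text \<open>A fibre is discrete and compact, hence finite. Small disjoint neighbourhoods of its
  points are the candidates for the sheets; the neighbourhood of \<open>y\<close> is shrunk until
  its preimage meets nothing else.\<close>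

lemma compact_local_homeomorphism_covering_space:
  fixes f :: "'a::metric_space \<Rightarrow> 'b::t2_space"
  assumes C: "compact C" and f: "continuous_on C f" and S: "f ` C = S"
    and loc: "\<And>x. x \<in> C \<Longrightarrow> \<exists>U g. x \<in> U \<and> openin (top_of_set C) U \<and>
                openin (top_of_set S) (f ` U) \<and> homeomorphism U (f ` U) f g"
  shows "covering_space C f S"
proof
  fix y assume y: "y \<in> S"
  define Z where "Z = C \<inter> f -` {y}"
  obtain U g where U: "\<And>x. x \<in> C \<Longrightarrow> x \<in> U x" "\<And>x. x \<in> C \<Longrightarrow> openin (top_of_set C) (U x)"
    "\<And>x. x \<in> C \<Longrightarrow> openin (top_of_set S) (f ` U x)" "\<And>x. x \<in> C \<Longrightarrow> homeomorphism (U x) (f ` U x) f (g x)"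
    using loc by metis
  have UC: "U x \<subseteq> C" if "x \<in> C" for x using U(2)[OF that] openin_imp_subset by blast
  have inj: "inj_on f (U x)" if "x \<in> C" for x
    using U(4)[OF that] by (metis homeomorphism_apply1 inj_on_inverseI)
  have "closedin (top_of_set C) Z"
    unfolding Z_def by (rule continuous_closedin_preimage[OF f]) simp
  then have "compact Z" using C closedin_compact by blast
  \<comment> \<open>An accumulation point of the fibre would lie in the fibre, against injectivity
    of \<open>f\<close> on its neighbourhood \<open>U l\<close>.\<close>
  have "finite Z"
  proof (rule ccontr)
    assume "infinite Z"
    then obtain l where l: "l \<in> Z" "l islimpt Z"
      using \<open>compact Z\<close> compact_eq_Bolzano_Weierstrass by blast
    then have lC: "l \<in> C" by (auto simp: Z_def)
    obtain O' where O': "open O'" "U l = C \<inter> O'" using U(2)[OF lC] by (auto simp: openin_open)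
    then have "l \<in> O'" using U(1)[OF lC] by auto
    then obtain z where "z \<in> Z" "z \<in> O'" "z \<noteq> l" using l(2) O'(1) unfolding islimpt_def by blast
    then have "z \<in> U l" "f z = f l" using O' l(1) by (auto simp: Z_def)
    then show False using inj[OF lC] \<open>z \<noteq> l\<close> U(1)[OF lC] by (auto simp: inj_on_def)
  qed
  have Zne: "Z \<noteq> {}" using y S by (auto simp: Z_def)
  obtain e where e: "e > 0" "\<And>x z. x \<in> Z \<Longrightarrow> z \<in> Z \<Longrightarrow> x \<noteq> z \<Longrightarrow> e \<le> dist x z"
  proof -
    have "\<exists>e>0. \<forall>x\<in>Z. \<forall>z\<in>Z. x \<noteq> z \<longrightarrow> e \<le> dist x z"
    proof -
      have "\<forall>x. \<exists>e>0. \<forall>z\<in>Z. x \<noteq> z \<longrightarrow> e \<le> dist x z" using finite_set_avoid[OF \<open>finite Z\<close>] by (metis)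
      then obtain ee where ee: "\<And>x. ee x > 0" "\<And>x z. z \<in> Z \<Longrightarrow> x \<noteq> z \<Longrightarrow> ee x \<le> dist x z" by metis
      show ?thesis
        by (rule exI[of _ "Min (ee ` Z)"])
          (use \<open>finite Z\<close> Zne ee in \<open>auto intro: order_trans[OF Min_le]\<close>)
    qed
    then show ?thesis using that by blast
  qed
  \<comment> \<open>Distinct points of the fibre are at distance at least \<open>e\<close>, so balls
    of radius \<open>e/2\<close> around them are disjoint.\<close>
  define W where "W x = U x \<inter> ball x (e/2)" for x
  have ZC: "x \<in> C" if "x \<in> Z" for x using that by (auto simp: Z_def)
  have WU: "W x \<subseteq> U x" for x by (auto simp: W_def)
  have W_open: "openin (top_of_set C) (W x)" if "x \<in> Z" for x
    unfolding W_def by (rule openin_Int_open) (use U ZC[OF that] in auto)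
  have W_disj: "W x \<inter> W z = {}" if xz: "x \<in> Z" "z \<in> Z" "x \<noteq> z" for x z
  proof -
    have "dist x z < e" if "p \<in> ball x (e/2)" "p \<in> ball z (e/2)" for p
      using that dist_triangle_half_r[of p x e z] by (simp add: dist_commute)
    then show ?thesis using e(2)[OF xz] unfolding W_def by fastforce
  qed
  have fW_open: "openin (top_of_set S) (f ` W x)" if "x \<in> Z" for x
  proof -
    have "openin (top_of_set (U x)) (W x)" unfolding W_def by (simp add: openin_open_Int)
    then have "openin (top_of_set (f ` U x)) (f ` W x)"
      using homeomorphism_imp_open_map U(4) ZC[OF that] by blast
    then show ?thesis using U(3) ZC[OF that] openin_trans by blast
  qed
  \<comment> \<open>\<open>K\<close> is the image of everything outside the candidate sheets:
    compact, hence closed, and without \<open>y\<close>. Removing it from the evenly covered set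
    leaves a neighbourhood of \<open>y\<close> whose preimage lies in the sheets.\<close>
  define K where "K = f ` (C - (\<Union>x\<in>Z. W x))"
  have "openin (top_of_set C) (\<Union>x\<in>Z. W x)" using W_open by blast
  then have "closedin (top_of_set C) (C - (\<Union>x\<in>Z. W x))" by auto
  then have "compact (C - (\<Union>x\<in>Z. W x))" using C closedin_compact by blast
  then have "compact K" unfolding K_def
    by (intro compact_continuous_image continuous_on_subset[OF f]) auto
  then have Kcl: "closed K" by (rule compact_imp_closed)
  define T where "T = (\<Inter>x\<in>Z. f ` W x) - K"
  have T_open: "openin (top_of_set S) T"
  proof -
    have "openin (top_of_set S) (\<Inter>x\<in>Z. f ` W x)"
      by (rule openin_INT2) (use fW_open \<open>finite Z\<close> Zne in auto)
    moreover have "T = (\<Inter>x\<in>Z. f ` W x) \<inter> (- K)" by (auto simp: T_def)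
    ultimately show ?thesis using Kcl by (simp add: openin_Int_open open_Compl)
  qed
  have xW: "x \<in> W x" if "x \<in> Z" for x using U(1) ZC[OF that] e(1) by (auto simp: W_def)
  have yT: "y \<in> T"
  proof -
    have "y \<in> f ` W x" if "x \<in> Z" for x using xW[OF that] that by (auto simp: Z_def)
    moreover have "y \<notin> K" using xW unfolding K_def Z_def by auto
    ultimately show ?thesis by (auto simp: T_def)
  qed
  define v where "v = (\<lambda>x. W x \<inter> f -` T) ` Z"
  show "\<exists>T. y \<in> T \<and> openin (top_of_set S) T \<and> (\<exists>v. \<Union> v = C \<inter> f -` T \<and>
        (\<forall>u\<in>v. openin (top_of_set C) u) \<and> pairwise disjnt v \<and> (\<forall>u\<in>v. \<exists>q. homeomorphism u T f q))"
  proof (intro exI[of _ T] exI[of _ v] conjI yT T_open ballI)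
    show "\<Union> v = C \<inter> f -` T"
    proof
      show "\<Union> v \<subseteq> C \<inter> f -` T" unfolding v_def using WU UC ZC by blast
      show "C \<inter> f -` T \<subseteq> \<Union> v" unfolding v_def T_def K_def by auto
    qed
    show "pairwise disjnt v" unfolding v_def pairwise_def disjnt_def using W_disj by blast
  next
    fix u assume "u \<in> v"
    then obtain x where x: "x \<in> Z" "u = W x \<inter> f -` T" by (auto simp: v_def)
    have "u = W x \<inter> (C \<inter> f -` T)" using x WU UC[OF ZC[OF x(1)]] by blast
    moreover have "openin (top_of_set C) (C \<inter> f -` T)"
      by (rule continuous_openin_preimage[OF f _ T_open]) (use S in auto)
    ultimately show "openin (top_of_set C) u" using W_open[OF x(1)] by auto
    have "homeomorphism u T f (g x)"
    proof (rule homeomorphism_of_subsets[OF U(4)[OF ZC[OF x(1)]]])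
      show "u \<subseteq> U x" using x WU by blast
      have "T \<subseteq> f ` W x" using x(1) unfolding T_def by blast
      then show "f ` u = T" unfolding x(2) by blast
      then show "T \<subseteq> f ` U x" using \<open>u \<subseteq> U x\<close> by blast
    qed
    then show "\<exists>q. homeomorphism u T f q" by blast
  qed
qed (use f S in auto)

section \<open>Conjugation of loops by a path, and self-coverings\<close>

lemma homotopic_paths_conjugate:
  fixes S :: "'a::real_normed_vector set"
  assumes d: "path d" "path_image d \<subseteq> S" and a: "path a" "path_image a \<subseteq> S"
    and ends: "pathstart a = pathfinish d" "pathfinish a = pathfinish d"
  shows "homotopic_paths S (reversepath d +++ ((d +++ (a +++ reversepath d)) +++ d)) a"
proof -
  define r where "r = reversepath d"
  define c where "c = linepath (pathfinish d) (pathfinish d)"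
  have r: "path r" "path_image r \<subseteq> S" "pathstart r = pathfinish d" "pathfinish r = pathstart d"
    using d by (auto simp: r_def)
  have c: "path c" "path_image c \<subseteq> S" "pathstart c = pathfinish d" "pathfinish c = pathfinish d"
    using d pathfinish_in_path_image[of d] by (auto simp: c_def)
  have c1: "homotopic_paths S (r +++ d) c" unfolding r_def c_def by (rule homotopic_paths_linv[OF d])
  note * = d a ends r c path_image_join subset_path_image_join
  have "homotopic_paths S ((a +++ r) +++ d) (a +++ (r +++ d))"
    by (rule homotopic_paths_sym[OF homotopic_paths_assoc]) (simp_all add: *)
  also have "homotopic_paths S (a +++ (r +++ d)) (a +++ c)"
    by (rule homotopic_paths_join) (simp_all add: * c1)
  also have "homotopic_paths S (a +++ c) a"
    unfolding c_def by (rule homotopic_paths_rid') (simp_all add: *)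
  finally have 1: "homotopic_paths S ((a +++ r) +++ d) a" .
  have "homotopic_paths S ((d +++ (a +++ r)) +++ d) (d +++ ((a +++ r) +++ d))"
    by (rule homotopic_paths_sym[OF homotopic_paths_assoc]) (simp_all add: *)
  also have "homotopic_paths S (d +++ ((a +++ r) +++ d)) (d +++ a)"
    by (rule homotopic_paths_join[OF _ 1]) (simp_all add: *)
  finally have "homotopic_paths S ((d +++ (a +++ r)) +++ d) (d +++ a)" .
  then have "homotopic_paths S (r +++ ((d +++ (a +++ r)) +++ d)) (r +++ (d +++ a))"
    by (rule homotopic_paths_join[rotated]) (simp_all add: *)
  also have "homotopic_paths S (r +++ (d +++ a)) ((r +++ d) +++ a)"
    by (rule homotopic_paths_assoc) (simp_all add: *)
  also have "homotopic_paths S ((r +++ d) +++ a) (c +++ a)"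
    by (rule homotopic_paths_join) (simp_all add: * c1)
  also have "homotopic_paths S (c +++ a) a"
    unfolding c_def by (rule homotopic_paths_lid') (simp_all add: *)
  finally show ?thesis unfolding r_def .
qed

text \<open>Up to homotopy, conjugation by \<open>d\<close> is undone by conjugation by its reverse,
  so it is injective on homotopy classes.\<close>

lemma homotopic_paths_conjugate_cancel:
  fixes S :: "'a::real_normed_vector set"
  assumes d: "path d" "path_image d \<subseteq> S"
    and a: "path a" "path_image a \<subseteq> S" "pathstart a = pathfinish d" "pathfinish a = pathfinish d"
    and b: "path b" "path_image b \<subseteq> S" "pathstart b = pathfinish d" "pathfinish b = pathfinish d"
    and hom: "homotopic_paths S (d +++ (a +++ reversepath d)) (d +++ (b +++ reversepath d))"
  shows "homotopic_paths S a b"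
proof -
  have "homotopic_paths S (reversepath d +++ ((d +++ (a +++ reversepath d)) +++ d))
      (reversepath d +++ ((d +++ (b +++ reversepath d)) +++ d))"
    by (intro homotopic_paths_join[OF _ homotopic_paths_join[OF hom]]) (use d a in simp_all)
  then show ?thesis
    using homotopic_paths_conjugate[OF d a] homotopic_paths_conjugate[OF d b]
      homotopic_paths_trans homotopic_paths_sym by metis
qed

text \<open>
  Conjugation by a path from \<open>x\<close> to \<open>f x\<close> turns the homomorphism that \<open>f\<close> induces into an
  injective self-map of the fundamental group at \<open>x\<close>. As that group is finite, the self-map is
  onto, so the image of a path between two points of a fibre is homotopic to the image of a loop.
\<close>

lemma covering_space_self_inj_on:
  fixes S :: "'a::real_normed_vector set"
  assumes cov: "covering_space S f S" and S: "path_connected S"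
    and fin: "\<And>x. x \<in> S \<Longrightarrow> finite ((\<lambda>p. {q. homotopic_paths S p q}) `
                {p. path p \<and> path_image p \<subseteq> S \<and> pathstart p = x \<and> pathfinish p = x})"
  shows "inj_on f S"
proof (rule inj_onI)
  fix x y assume x: "x \<in> S" and y: "y \<in> S" and xy: "f x = f y"
  define L where "L = {p. path p \<and> path_image p \<subseteq> S \<and> pathstart p = x \<and> pathfinish p = x}"
  define cls where "cls p = {q. homotopic_paths S p q}" for p
  have cls_eq: "cls p = cls q \<longleftrightarrow> homotopic_paths S p q" if "p \<in> L" "q \<in> L" for p q
  proof
    assume "cls p = cls q"
    moreover have "q \<in> cls q" using that by (simp add: cls_def L_def)
    ultimately show "homotopic_paths S p q" by (auto simp: cls_def)
  next
    assume "homotopic_paths S p q"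
    then show "cls p = cls q"
      unfolding cls_def using homotopic_paths_trans homotopic_paths_sym by blast
  qed
  have contf: "continuous_on S f" and fS: "f ` S = S"
    using cov covering_space_imp_continuous covering_space_imp_surjective by blast+
  have "f x \<in> S" using x fS by blast
  then obtain d where d: "path d" "path_image d \<subseteq> S" "pathstart d = x" "pathfinish d = f x"
    using S x unfolding path_connected_def by metis
  \<comment> \<open>\<open>p\<close> need not be closed: it is enough that it ends in the fibre of
    \<open>f x\<close>, so \<open>\<Phi>\<close> applies to loops at \<open>x\<close> and also to a
    path from \<open>x\<close> to \<open>y\<close>.\<close>
  define \<Phi> where "\<Phi> p = d +++ ((f \<circ> p) +++ reversepath d)" for p
  have fp: "path (f \<circ> p)" "path_image (f \<circ> p) \<subseteq> S" if "path p" "path_image p \<subseteq> S" for p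
    using that contf fS by (auto simp: path_image_compose intro: path_continuous_image continuous_on_subset)
  have \<Phi>L: "\<Phi> p \<in> L" if p: "path p" "path_image p \<subseteq> S" "pathstart p = x" "f (pathfinish p) = f x" for p
    using fp[OF p(1,2)] p(3,4) d
    by (simp add: L_def \<Phi>_def pathstart_compose pathfinish_compose subset_path_image_join)
  have cancel: "homotopic_paths S (f \<circ> p) (f \<circ> q)"
    if p: "path p" "path_image p \<subseteq> S" "pathstart p = x" "f (pathfinish p) = f x"
      and q: "path q" "path_image q \<subseteq> S" "pathstart q = x" "f (pathfinish q) = f x"
      and "homotopic_paths S (\<Phi> p) (\<Phi> q)" for p q
    by (rule homotopic_paths_conjugate_cancel[OF d(1,2)])
       (use fp[OF p(1,2)] fp[OF q(1,2)] p(3,4) q(3,4) d that(9) in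
         \<open>simp_all add: pathstart_compose pathfinish_compose \<Phi>_def\<close>)
  \<comment> \<open>With chosen representatives \<open>\<Psi>\<close> is a map on classes without a
    proof that it respects homotopy.\<close>
  define rep where "rep P = (SOME p. p \<in> L \<and> cls p = P)" for P
  have rep: "rep P \<in> L" "cls (rep P) = P" if "P \<in> cls ` L" for P
    using someI_ex[of "\<lambda>p. p \<in> L \<and> cls p = P"] that unfolding rep_def by auto
  have LD: "path p" "path_image p \<subseteq> S" "pathstart p = x" "f (pathfinish p) = f x" if "p \<in> L" for p
    using that by (auto simp: L_def)
  define \<Psi> where "\<Psi> P = cls (\<Phi> (rep P))" for P
  have "inj_on \<Psi> (cls ` L)"
  proof (rule inj_onI)
    fix P Q assume PQ: "P \<in> cls ` L" "Q \<in> cls ` L" "\<Psi> P = \<Psi> Q"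
    have h: "homotopic_paths S (\<Phi> (rep P)) (\<Phi> (rep Q))"
      using PQ(3) cls_eq[OF \<Phi>L[OF LD] \<Phi>L[OF LD]] rep(1)[OF PQ(1)] rep(1)[OF PQ(2)] by (simp add: \<Psi>_def)
    have h: "homotopic_paths S (f \<circ> rep P) (f \<circ> rep Q)"
      by (rule cancel[OF LD LD h]) (use rep PQ in auto)
    have "homotopic_paths S (rep P) (rep Q)"
      by (rule covering_space_lift_homotopic_paths[OF cov _ _ _ _ h])
        (use LD[OF rep(1)[OF PQ(1)]] LD[OF rep(1)[OF PQ(2)]] fp in auto)
    then show "P = Q" using cls_eq rep PQ by metis
  qed
  moreover have "\<Psi> ` (cls ` L) \<subseteq> cls ` L" unfolding \<Psi>_def using \<Phi>L[OF LD] rep(1) by auto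
  moreover have "finite (cls ` L)" using fin[OF x] unfolding cls_def L_def .
  ultimately have onto: "\<Psi> ` (cls ` L) = cls ` L" by (intro endo_inj_surj)
  obtain q where q: "path q" "path_image q \<subseteq> S" "pathstart q = x" "pathfinish q = y"
    using S x y unfolding path_connected_def by metis
  have "cls (\<Phi> q) \<in> cls ` L" using \<Phi>L q xy by auto
  then have "cls (\<Phi> q) \<in> \<Psi> ` (cls ` L)" by (simp only: onto)
  then obtain P where P: "P \<in> cls ` L" "cls (\<Phi> q) = \<Psi> P" by (rule imageE)
  define l where "l = rep P"
  have l: "l \<in> L" using rep(1) P(1) by (simp add: l_def)
  have "homotopic_paths S (\<Phi> l) (\<Phi> q)"
    using P(2) cls_eq[OF \<Phi>L[OF LD[OF l]] \<Phi>L[OF q(1,2,3)]] q xy by (simp add: \<Psi>_def l_def)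
  then have h: "homotopic_paths S (f \<circ> l) (f \<circ> q)"
    using cancel[OF LD[OF l] q(1,2,3)] q xy by simp
  \<comment> \<open>\<open>l\<close> and \<open>q\<close> are lifts of homotopic paths and both
    start at \<open>x\<close>, so they have the same end. The loop \<open>l\<close> ends at
    \<open>x\<close> and \<open>q\<close> ends at \<open>y\<close>.\<close>
  have "pathfinish l = pathfinish q"
    by (rule covering_space_monodromy[OF cov _ _ _ _ h]) (use LD[OF l] q fp in auto)
  then show "x = y" using l q by (simp add: L_def)
qed

section \<open>Holomorphic functions of several variables\<close>

lemma norm_vector_smult: "norm (c *s v) = norm c * norm v" for v :: "complex^'n"
  by (simp add: norm_vec_def norm_mult L2_set_right_distrib)

lemma bounded_linear_vector_smult_left: "bounded_linear (\<lambda>t. t *s v)" for v :: "complex^'n"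
  by (rule bounded_linear_intro[where K="norm v"])
     (simp_all add: vec_eq_iff algebra_simps norm_vector_smult)

text \<open>Taylor's formula with a bound for the second derivative on \<open>ball 0 (r/2)\<close>.
  Cauchy's inequality on discs of radius \<open>r/4\<close> gives \<open>2 * M / (r/4)^2\<close>,
  whence the constant 32. As the bound depends on \<open>k\<close> only through \<open>M\<close> and
  \<open>r\<close>, it is uniform in families.\<close>

lemma difference_quotient_bound:
  assumes k: "k holomorphic_on ball 0 r" and M: "\<And>\<zeta>. \<zeta> \<in> ball 0 r \<Longrightarrow> cmod (k \<zeta>) \<le> M"
    and e: "e \<noteq> 0" "cmod e < r/2"
  shows "cmod ((k e - k 0) / e - deriv k 0) \<le> 32 * M / r^2 * cmod e"
proof -
  have r: "r > 0" using e by (smt (verit) norm_ge_zero half_gt_zero_iff)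
  have sub: "cball x (r/4) \<subseteq> ball 0 r" if "x \<in> ball 0 (r/2)" for x :: complex
  proof
    fix y assume "y \<in> cball x (r/4)"
    then show "y \<in> ball 0 r" using that r norm_triangle_ineq2[of y x]
      by (simp add: dist_norm norm_minus_commute)
  qed
  have "cmod ((deriv ^^ 0) k e - (\<Sum>i\<le>1. (deriv ^^ i) k 0 * (e - 0) ^ i / fact i))
      \<le> (32 * M / r^2) * cmod (e - 0) ^ Suc 1 / fact 1"
  proof (rule complex_Taylor[of "ball 0 (r/2)" 1 "\<lambda>i. (deriv ^^ i) k"])
    fix i :: nat and x :: complex assume "x \<in> ball 0 (r/2)"
    then have "x \<in> ball 0 r" using r by auto
    then show "((deriv ^^ i) k has_field_derivative (deriv ^^ Suc i) k x) (at x within ball 0 (r/2))"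
      using holomorphic_derivI[OF holomorphic_higher_deriv[OF k open_ball, of i] open_ball] by simp
  next
    fix x :: complex assume x: "x \<in> ball 0 (r/2)"
    have "cmod ((deriv ^^ 2) k x) \<le> fact 2 * M / (r/4)^2"
    proof (rule Cauchy_inequality)
      show "k holomorphic_on ball x (r/4)"
        using k sub[OF x] ball_subset_cball holomorphic_on_subset by blast
      show "continuous_on (cball x (r/4)) k"
        using k sub[OF x] holomorphic_on_imp_continuous_on holomorphic_on_subset by blast
      show "cmod (k y) \<le> M" if "cmod (x - y) = r/4" for y
        using that sub[OF x] M[of y] by (auto simp: dist_norm subset_iff)
    qed (use r in auto)
    then show "cmod ((deriv ^^ Suc 1) k x) \<le> 32 * M / r^2"
      by (simp add: numeral_2_eq_2 power2_eq_square)
  qed (use e r in auto)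
  then have *: "cmod (k e - k 0 - deriv k 0 * e) \<le> 32 * M / r^2 * cmod e * cmod e"
    by (simp add: algebra_simps)
  have "(k e - k 0) / e - deriv k 0 = (k e - k 0 - deriv k 0 * e) / e" using e by (simp add: field_simps)
  then show ?thesis using * e by (simp add: norm_divide divide_le_eq)
qed

text \<open>
  Continuity and holomorphy along complex lines are enough for the maximum modulus principle,
  and partial derivatives of holomorphic functions inherit both from the one-variable theory,
  as locally uniform limits of difference quotients.
\<close>

definition holo_on_lines :: "(complex^'n \<Rightarrow> complex) \<Rightarrow> (complex^'n) set \<Rightarrow> bool" where
  "holo_on_lines g U \<longleftrightarrow> continuous_on U g \<and>
     (\<forall>z w. (\<lambda>t. g (z + t *s w)) holomorphic_on {t. z + t *s w \<in> U})"

lemma continuous_on_line: "continuous_on T (\<lambda>t. z + t *s w)" for z w :: "complex^'n"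
  by (intro continuous_intros linear_continuous_on bounded_linear_vector_smult_left)

lemma open_line_preimage: "open U \<Longrightarrow> open {t. z + t *s w \<in> U}" for z w :: "complex^'n"
  using open_vimage[OF _ continuous_on_line, of U z w] by (simp add: vimage_def)

lemma holo_fun_on_subset: "holo_fun_on g U \<Longrightarrow> V \<subseteq> U \<Longrightarrow> holo_fun_on g V"
  by (auto simp: holo_fun_on_def)

lemma holo_fun_on_frechet:
  assumes "holo_fun_on g U" "x \<in> U"
  shows "(g has_derivative frechet_derivative g (at x)) (at x)"
    "frechet_derivative g (at x) (c *s v) = c * frechet_derivative g (at x) v"
  using assms frechet_derivative_at unfolding holo_fun_on_def by metis+

lemma holo_map_on_frechet:
  assumes "holo_map_on g U" "x \<in> U"
  shows "(g has_derivative frechet_derivative g (at x)) (at x)"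
    "frechet_derivative g (at x) (c *s v) = c *s frechet_derivative g (at x) v"
  using assms frechet_derivative_at unfolding holo_map_on_def by metis+

lemma holo_fun_on_imp_continuous_on: "holo_fun_on g U \<Longrightarrow> continuous_on U g"
  by (meson holo_fun_on_frechet(1) continuous_at_imp_continuous_on has_derivative_continuous)

lemma holo_fun_on_DERIV_line:
  assumes g: "holo_fun_on g U" and t: "z + t *s w \<in> U"
  shows "((\<lambda>s. g (z + s *s w)) has_field_derivative frechet_derivative g (at (z + t *s w)) w) (at t)"
proof -
  note D = holo_fun_on_frechet[OF g t]
  have "((\<lambda>s. z + s *s w) has_derivative (\<lambda>h. 0 + h *s w)) (at t)"
    by (intro has_derivative_add has_derivative_const bounded_linear_imp_has_derivative
        bounded_linear_vector_smult_left)
  from has_derivative_compose[OF this, of g] D(1)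
  have "((\<lambda>s. g (z + s *s w)) has_derivative (\<lambda>h. frechet_derivative g (at (z + t *s w)) (h *s w))) (at t)"
    by simp
  then show ?thesis
    unfolding has_field_derivative_def D(2) by (simp add: mult.commute[of _ "frechet_derivative g _ _"])
qed

lemma holo_on_lines_holo_fun:
  assumes "holo_fun_on g U"
  shows "holo_on_lines g U"
  unfolding holo_on_lines_def
proof (intro conjI allI)
  show "(\<lambda>t. g (z + t *s w)) holomorphic_on {t. z + t *s w \<in> U}" for z w
    unfolding holomorphic_on_def field_differentiable_def
    using holo_fun_on_DERIV_line[OF assms] has_field_derivative_at_within by blast
qed (rule holo_fun_on_imp_continuous_on[OF assms])

text \<open>Near \<open>z0\<close> one disc radius and one bound for \<open>g\<close> serve all
  lines in direction \<open>v\<close>, so the one-variable estimate makes the convergence of the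
  difference quotients uniform.\<close>

lemma uniform_limit_directional_derivative:
  fixes g :: "complex^'n \<Rightarrow> complex" and v :: "complex^'n"
  assumes U: "open U" and g: "holo_fun_on g U" and z0: "z0 \<in> U"
  defines "Q \<equiv> \<lambda>n z. (g (z + inverse (of_nat (Suc n)) *s v) - g z) / inverse (of_nat (Suc n))"
  shows "\<exists>\<rho>>0. cball z0 \<rho> \<subseteq> U \<and> uniform_limit (cball z0 \<rho>) Q (\<lambda>z. frechet_derivative g (at z) v) sequentially
      \<and> (\<forall>\<^sub>F n in sequentially. holo_on_lines (Q n) (cball z0 \<rho>))"
proof -
  obtain R where R: "R > 0" "cball z0 R \<subseteq> U" using U z0 open_contains_cball by blast
  have "compact (g ` cball z0 R)"
    by (meson R(2) compact_cball compact_continuous_image continuous_on_subset g holo_fun_on_imp_continuous_on)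
  then obtain M where M: "\<And>z. z \<in> cball z0 R \<Longrightarrow> cmod (g z) \<le> M"
    using compact_imp_bounded bounded_iff by (metis imageI)
  \<comment> \<open>With this \<open>r\<close>, a point within \<open>R/2\<close> of
    \<open>z0\<close> moved by less than \<open>r\<close> in direction \<open>v\<close> stays within
    \<open>R\<close> of \<open>z0\<close>. The summand 1 covers \<open>v = 0\<close>.\<close>
  define r where "r = R / (2 * (norm v + 1))"
  have r: "r > 0" "r * norm v \<le> R/2"
    using R(1) by (auto simp: r_def field_simps add_pos_nonneg)
  have inU: "z + \<zeta> *s v \<in> cball z0 R" if "z \<in> cball z0 (R/2)" "\<zeta> \<in> ball 0 r" for z \<zeta>
  proof -
    have "norm (\<zeta> *s v) \<le> r * norm v" using that(2) by (auto simp: norm_vector_smult intro!: mult_right_mono)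
    then have "norm (\<zeta> *s v) \<le> R/2" using r(2) by linarith
    then show ?thesis using that(1) norm_triangle_ineq[of "z - z0" "\<zeta> *s v"]
      by (simp add: dist_norm norm_minus_commute[of z0] algebra_simps)
  qed
  have bound: "cmod ((g (z + e *s v) - g z) / e - frechet_derivative g (at z) v) \<le> 32 * M / r^2 * cmod e"
    if z: "z \<in> cball z0 (R/2)" and e: "e \<noteq> 0" "cmod e < r/2" for z e
  proof -
    define k where "k = (\<lambda>\<zeta>. g (z + \<zeta> *s v))"
    have kd: "(k has_field_derivative frechet_derivative g (at (z + \<zeta> *s v)) v) (at \<zeta>)" if "\<zeta> \<in> ball 0 r" for \<zeta>
      unfolding k_def by (rule holo_fun_on_DERIV_line[OF g]) (use inU[OF z that] R in auto)
    then have "k holomorphic_on ball 0 r" unfolding holomorphic_on_open[OF open_ball] by blast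
    moreover have "cmod (k \<zeta>) \<le> M" if "\<zeta> \<in> ball 0 r" for \<zeta> using inU[OF z that] M by (simp add: k_def)
    ultimately have "cmod ((k e - k 0) / e - deriv k 0) \<le> 32 * M / r^2 * cmod e"
      using e by (rule difference_quotient_bound)
    moreover have "deriv k 0 = frechet_derivative g (at z) v" using DERIV_imp_deriv[OF kd[of 0]] r by simp
    ultimately show ?thesis by (simp add: k_def)
  qed
  have lim: "(\<lambda>n. inverse (real (Suc n))) \<longlonglongrightarrow> 0" by (rule LIMSEQ_inverse_real_of_nat)
  have ncmod: "cmod (inverse (of_nat (Suc n))) = inverse (real (Suc n))" for n
    by (simp add: norm_inverse del: of_nat_Suc)
  have small: "\<forall>\<^sub>F n in sequentially. inverse (real (Suc n)) < r/2"
    using order_tendstoD(2)[OF lim, of "r/2"] r by simp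
  have "uniform_limit (cball z0 (R/2)) Q (\<lambda>z. frechet_derivative g (at z) v) sequentially"
  proof (rule uniform_limitI)
    fix \<epsilon> :: real assume "\<epsilon> > 0"
    have "(\<lambda>n. 32 * M / r^2 * inverse (real (Suc n))) \<longlonglongrightarrow> 32 * M / r^2 * 0"
      by (intro tendsto_intros lim)
    then have "\<forall>\<^sub>F n in sequentially. 32 * M / r^2 * inverse (real (Suc n)) < \<epsilon>"
      using \<open>\<epsilon> > 0\<close> order_tendstoD(2) by fastforce
    with small show "\<forall>\<^sub>F n in sequentially. \<forall>z\<in>cball z0 (R/2). dist (Q n z) (frechet_derivative g (at z) v) < \<epsilon>"
    proof eventually_elim
      case (elim n)
      show ?case
      proof
        fix z assume "z \<in> cball z0 (R/2)"
        then have "cmod (Q n z - frechet_derivative g (at z) v) \<le> 32 * M / r^2 * cmod (inverse (of_nat (Suc n)))"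
          unfolding Q_def by (rule bound) (use elim ncmod in \<open>simp_all del: of_nat_Suc\<close>)
        then show "dist (Q n z) (frechet_derivative g (at z) v) < \<epsilon>"
          using elim ncmod by (simp add: dist_norm del: of_nat_Suc)
      qed
    qed
  qed
  moreover have "\<forall>\<^sub>F n in sequentially. holo_on_lines (Q n) (cball z0 (R/2))"
    using small
  proof eventually_elim
    case (elim n)
    define e :: complex where "e = inverse (of_nat (Suc n))"
    have e: "e \<in> ball 0 r" using elim ncmod r by (simp add: e_def del: of_nat_Suc)
    have cb: "z \<in> U" "z + e *s v \<in> U" if "z \<in> cball z0 (R/2)" for z
      using inU[OF that e] inU[OF that, of 0] r R by auto
    have gl: "continuous_on U g" "\<And>z w. (\<lambda>t. g (z + t *s w)) holomorphic_on {t. z + t *s w \<in> U}"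
      using holo_on_lines_holo_fun[OF g] by (auto simp: holo_on_lines_def)
    have c1: "continuous_on (cball z0 (R/2)) (\<lambda>z. g (z + e *s v))"
      by (rule continuous_on_compose2[OF gl(1)]) (use cb in \<open>auto intro!: continuous_intros\<close>)
    have c2: "continuous_on (cball z0 (R/2)) g"
      by (rule continuous_on_subset[OF gl(1)]) (use cb in auto)
    have h1: "(\<lambda>t. g (z + t *s w)) holomorphic_on {t. z + t *s w \<in> cball z0 (R/2)}" for z w
      by (rule holomorphic_on_subset[OF gl(2)]) (use cb in auto)
    have h2: "(\<lambda>t. g (z + t *s w + e *s v)) holomorphic_on {t. z + t *s w \<in> cball z0 (R/2)}" for z w
    proof -
      have eq: "(z + e *s v) + t *s w = z + t *s w + e *s v" for t by simp
      have "(\<lambda>t. g ((z + e *s v) + t *s w)) holomorphic_on {t. z + t *s w \<in> cball z0 (R/2)}"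
        by (rule holomorphic_on_subset[OF gl(2)]) (use cb in \<open>auto simp: eq\<close>)
      then show ?thesis by (simp only: eq)
    qed
    have "e \<noteq> 0" unfolding e_def by (simp del: of_nat_Suc)
    then show ?case
      unfolding holo_on_lines_def Q_def e_def[symmetric]
      by (intro conjI allI continuous_intros holomorphic_intros c1 c2 h1 h2) auto
  qed
  moreover have "R/2 > 0" "cball z0 (R/2) \<subseteq> U" using R by auto
  ultimately show ?thesis by blast
qed

text \<open>This upgrades pointwise differentiability to a continuous derivative. Along each line
  holomorphy passes to the uniform limit.\<close>

lemma holo_on_lines_directional_derivative:
  fixes g :: "complex^'n \<Rightarrow> complex"
  assumes U: "open U" and g: "holo_fun_on g U"
  shows "holo_on_lines (\<lambda>z. frechet_derivative g (at z) v) U" (is "holo_on_lines ?P U")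
  unfolding holo_on_lines_def
proof (intro conjI allI)
  show "continuous_on U ?P"
    unfolding continuous_on_eq_continuous_at[OF U]
  proof
    fix z0 assume "z0 \<in> U"
    then obtain \<rho> Q where \<rho>: "\<rho> > 0" "uniform_limit (cball z0 \<rho>) Q ?P sequentially"
      "\<forall>\<^sub>F n in sequentially. holo_on_lines (Q n) (cball z0 \<rho>)"
      using uniform_limit_directional_derivative[OF U g, of z0 v] by blast
    have "continuous_on (cball z0 \<rho>) ?P"
      by (rule uniform_limit_theorem[OF _ \<rho>(2)])
        (use \<rho>(3) in \<open>auto simp: holo_on_lines_def elim!: eventually_mono\<close>)
    then show "isCont ?P z0"
      using \<rho>(1) continuous_on_interior by fastforce
  qed
  fix z w
  show "(\<lambda>t. ?P (z + t *s w)) holomorphic_on {t. z + t *s w \<in> U}" (is "?h holomorphic_on ?T")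
    unfolding holomorphic_on_def
  proof
    fix t assume t: "t \<in> ?T"
    then obtain \<rho> Q where \<rho>: "\<rho> > 0" "uniform_limit (cball (z + t *s w) \<rho>) Q ?P sequentially"
      "\<forall>\<^sub>F n in sequentially. holo_on_lines (Q n) (cball (z + t *s w) \<rho>)"
      using uniform_limit_directional_derivative[OF U g, of "z + t *s w" v] by blast
    have "open {s. z + s *s w \<in> ball (z + t *s w) \<rho>}" by (rule open_line_preimage) simp
    moreover have "t \<in> {s. z + s *s w \<in> ball (z + t *s w) \<rho>}" using \<rho> by simp
    ultimately obtain d where d: "d > 0" "cball t d \<subseteq> {s. z + s *s w \<in> ball (z + t *s w) \<rho>}"
      using open_contains_cball by blast
    have sub: "z + s *s w \<in> cball (z + t *s w) \<rho>" if "s \<in> cball t d" for s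
      using d(2) that by fastforce
    have "\<forall>\<^sub>F n in sequentially. continuous_on (cball t d) (\<lambda>s. Q n (z + s *s w)) \<and>
        (\<lambda>s. Q n (z + s *s w)) holomorphic_on ball t d"
      using \<rho>(3)
    proof eventually_elim
      case (elim n)
      then have "(\<lambda>s. Q n (z + s *s w)) holomorphic_on {s. z + s *s w \<in> cball (z + t *s w) \<rho>}"
        unfolding holo_on_lines_def by blast
      then have "(\<lambda>s. Q n (z + s *s w)) holomorphic_on cball t d"
        by (rule holomorphic_on_subset) (use sub in blast)
      then show ?case
        using holomorphic_on_imp_continuous_on holomorphic_on_subset ball_subset_cball by blast
    qed
    moreover have "uniform_limit (cball t d) (\<lambda>n s. Q n (z + s *s w)) ?h sequentially"
      using \<rho>(2) sub unfolding uniform_limit_iff by (fastforce elim!: eventually_mono)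
    ultimately have "?h holomorphic_on ball t d"
      by (rule holomorphic_uniform_limit[OF _ _ trivial_limit_sequentially])
    then show "?h field_differentiable at t within ?T"
      by (meson \<open>0 < d\<close> centre_in_ball field_differentiable_at_within holomorphic_on_imp_differentiable_at open_ball)
  qed
qed


lemma holo_on_lines_cong:
  assumes "\<And>z. z \<in> U \<Longrightarrow> g z = h z"
  shows "holo_on_lines g U \<longleftrightarrow> holo_on_lines h U"
proof -
  have "(\<lambda>t. g (z + t *s w)) holomorphic_on {t. z + t *s w \<in> U} \<longleftrightarrow>
      (\<lambda>t. h (z + t *s w)) holomorphic_on {t. z + t *s w \<in> U}" for z w
    by (rule holomorphic_cong) (use assms in auto)
  moreover have "continuous_on U g \<longleftrightarrow> continuous_on U h" by (rule continuous_on_cong[OF refl assms])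
  ultimately show ?thesis unfolding holo_on_lines_def by blast
qed

lemma holo_on_lines_const: "holo_on_lines (\<lambda>_. c) U"
  by (auto simp: holo_on_lines_def)

lemma holo_on_lines_mult:
  "holo_on_lines g U \<Longrightarrow> holo_on_lines h U \<Longrightarrow> holo_on_lines (\<lambda>z. g z * h z) U"
  by (auto simp: holo_on_lines_def intro!: continuous_intros holomorphic_intros)

lemma holo_on_lines_divide:
  "holo_on_lines g U \<Longrightarrow> holo_on_lines h U \<Longrightarrow> (\<And>z. z \<in> U \<Longrightarrow> h z \<noteq> 0) \<Longrightarrow> holo_on_lines (\<lambda>z. g z / h z) U"
  by (auto simp: holo_on_lines_def intro!: continuous_intros holomorphic_intros)

lemma holo_on_lines_power: "holo_on_lines g U \<Longrightarrow> holo_on_lines (\<lambda>z. g z ^ m) U"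
  by (auto simp: holo_on_lines_def intro!: continuous_intros holomorphic_intros)

lemma holo_on_lines_sum:
  "(\<And>i. i \<in> I \<Longrightarrow> holo_on_lines (g i) U) \<Longrightarrow> holo_on_lines (\<lambda>z. \<Sum>i\<in>I. g i z) U"
  by (auto simp: holo_on_lines_def intro!: continuous_intros holomorphic_intros)

lemma holo_on_lines_prod:
  "(\<And>i. i \<in> I \<Longrightarrow> holo_on_lines (g i) U) \<Longrightarrow> holo_on_lines (\<lambda>z. \<Prod>i\<in>I. g i z) U"
  by (auto simp: holo_on_lines_def intro!: continuous_intros holomorphic_intros)

lemma holo_map_on_component:
  fixes F :: "complex^'n \<Rightarrow> complex^'m"
  assumes F: "holo_map_on F U"
  shows "holo_fun_on (\<lambda>z. F z $ i) U"
    and "z \<in> U \<Longrightarrow> frechet_derivative (\<lambda>z. F z $ i) (at z) v = frechet_derivative F (at z) v $ i"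
proof -
  have D: "((\<lambda>z. F z $ i) has_derivative (\<lambda>v. frechet_derivative F (at z) v $ i)) (at z)" if "z \<in> U" for z
    by (rule bounded_linear.has_derivative[OF bounded_linear_vec_nth holo_map_on_frechet(1)[OF F that]])
  show "holo_fun_on (\<lambda>z. F z $ i) U"
    unfolding holo_fun_on_def
  proof
    fix z assume z: "z \<in> U"
    show "\<exists>D. ((\<lambda>z. F z $ i) has_derivative D) (at z) \<and> (\<forall>c v. D (c *s v) = c * D v)"
      by (intro exI[of _ "\<lambda>v. frechet_derivative F (at z) v $ i"] conjI D z)
        (simp add: holo_map_on_frechet(2)[OF F z])
  qed
  show "frechet_derivative (\<lambda>z. F z $ i) (at z) v = frechet_derivative F (at z) v $ i" if "z \<in> U"
    using fun_cong[OF frechet_derivative_at[OF D[OF that]], of v] by simp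
qed

text \<open>The determinant is a polynomial in the partial derivatives of the components.\<close>

lemma holo_on_lines_det_jacobian:
  fixes F :: "complex^'n \<Rightarrow> complex^'n"
  assumes U: "open U" and F: "holo_map_on F U"
  shows "holo_on_lines (\<lambda>z. det (jacobian F (at z))) U"
proof -
  have "holo_on_lines (\<lambda>z. det (\<chi> i j. frechet_derivative (\<lambda>z. F z $ i) (at z) (axis j 1))) U"
    unfolding det_def
    by (auto intro!: holo_on_lines_sum holo_on_lines_prod holo_on_lines_mult holo_on_lines_const
        holo_on_lines_directional_derivative[OF U] holo_map_on_component(1)[OF F])
  moreover have "jacobian F (at z) = (\<chi> i j. frechet_derivative (\<lambda>z. F z $ i) (at z) (axis j 1))"
    if "z \<in> U" for z
    using holo_map_on_component(2)[OF F that] by (simp add: jacobian_def matrix_def)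
  ultimately show ?thesis using holo_on_lines_cong by (smt (verit))
qed

text \<open>The complex line through \<open>z0\<close> and \<open>z\<close> meets the ball in a
  disc, parametrised so that \<open>z0\<close> is at 0 and \<open>z\<close> at 1. The one-variable
  principle applies to the restriction of \<open>g\<close> to this disc.\<close>

lemma holo_on_lines_maximum_modulus:
  fixes g :: "complex^'n \<Rightarrow> complex"
  assumes g: "holo_on_lines g U" and sub: "ball z0 r \<subseteq> U"
    and max: "\<And>z. z \<in> ball z0 r \<Longrightarrow> cmod (g z) \<le> cmod (g z0)" and z: "z \<in> ball z0 r"
  shows "cmod (g z) = cmod (g z0)"
proof (cases "z = z0")
  case False
  define w where "w = z - z0"
  have w: "norm w > 0" "norm w < r" using False z by (auto simp: w_def dist_norm norm_minus_commute)
  then have r: "0 < r" by linarith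
  define T where "T = ball (0::complex) (r / norm w)"
  have inb: "z0 + t *s w \<in> ball z0 r" if "t \<in> T" for t
    using that w(1) by (simp add: T_def dist_norm norm_vector_smult pos_less_divide_eq)
  have "(\<lambda>t. g (z0 + t *s w)) constant_on T"
  proof (rule maximum_modulus_principle[where U = T and \<xi> = 0])
    show "(\<lambda>t. g (z0 + t *s w)) holomorphic_on T"
      by (rule holomorphic_on_subset[of _ "{t. z0 + t *s w \<in> U}"])
        (use g inb sub in \<open>auto simp: holo_on_lines_def\<close>)
    show "cmod (g (z0 + t *s w)) \<le> cmod (g (z0 + 0 *s w))" if "t \<in> T" for t
      using max[OF inb[OF that]] by simp
    show "0 \<in> T" using w r by (simp add: T_def)
  qed (auto simp: T_def)
  moreover have "0 \<in> T" "1 \<in> T" using w r by (auto simp: T_def pos_less_divide_eq)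
  ultimately have "g (z0 + 1 *s w) = g (z0 + 0 *s w)" unfolding constant_on_def by metis
  then show ?thesis by (simp add: w_def)
qed simp

section \<open>Chain rule, local inverses and Sard's theorem for holomorphic maps\<close>

lemma holo_map_on_frechet_linear:
  assumes "holo_map_on F U" "x \<in> U"
  shows "Vector_Spaces.linear (*s) (*s) (frechet_derivative F (at x))"
  using holo_map_on_frechet[OF assms] linear_add[OF has_derivative_linear[OF holo_map_on_frechet(1)[OF assms]]]
  by (simp add: Vector_Spaces.linear_iff vec.vector_space_axioms)

text \<open>\<open>H\<close> has to agree with the composite only near \<open>x\<close>, since
  coordinate expressions on a manifold compose only where the intermediate chart is defined.\<close>

lemma det_jacobian_compose:
  fixes F G :: "complex^'n \<Rightarrow> complex^'n"
  assumes F: "holo_map_on F U" "x \<in> U" and G: "holo_map_on G V" "F x \<in> V"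
    and W: "open W" "x \<in> W" and H: "\<And>z. z \<in> W \<Longrightarrow> H z = G (F z)"
  shows "det (jacobian H (at x)) = det (jacobian G (at (F x))) * det (jacobian F (at x))"
proof -
  have "(G \<circ> F has_derivative frechet_derivative G (at (F x)) \<circ> frechet_derivative F (at x)) (at x)"
    by (intro diff_chain_at holo_map_on_frechet(1)[OF F] holo_map_on_frechet(1)[OF G])
  then have "(H has_derivative frechet_derivative G (at (F x)) \<circ> frechet_derivative F (at x)) (at x)"
    by (rule has_derivative_transform_within_open[OF _ W]) (simp add: H)
  then have "frechet_derivative H (at x) = frechet_derivative G (at (F x)) \<circ> frechet_derivative F (at x)"
    by (rule frechet_derivative_at[symmetric])
  then show ?thesis
    by (simp add: jacobian_def matrix_compose_gen holo_map_on_frechet_linear[OF F] holo_map_on_frechet_linear[OF G] det_mul)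
qed

lemma holo_fun_on_compose:
  assumes F: "holo_map_on F U" and G: "holo_fun_on G V" "F ` U \<subseteq> V"
  shows "holo_fun_on (G \<circ> F) U"
  unfolding holo_fun_on_def
proof
  fix x assume x: "x \<in> U"
  then have Fx: "F x \<in> V" using G(2) by blast
  show "\<exists>D. (G \<circ> F has_derivative D) (at x) \<and> (\<forall>c v. D (c *s v) = c * D v)"
    by (intro exI[of _ "frechet_derivative G (at (F x)) \<circ> frechet_derivative F (at x)"] conjI diff_chain_at
        holo_map_on_frechet(1)[OF F x] holo_fun_on_frechet(1)[OF G(1) Fx])
      (simp add: holo_map_on_frechet(2)[OF F x] holo_fun_on_frechet(2)[OF G(1) Fx])
qed

lemma frechet_derivative_left_inverse:
  fixes F :: "complex^'n \<Rightarrow> complex^'n"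
  assumes F: "holo_map_on F U" "x \<in> U" and det: "det (jacobian F (at x)) \<noteq> 0"
  shows "\<exists>E. bounded_linear E \<and> (\<forall>c v. E (c *s v) = c *s E v) \<and>
    (\<forall>v. E (frechet_derivative F (at x) v) = v)"
proof -
  let ?D = "frechet_derivative F (at x)"
  have D: "linear ?D" using has_derivative_linear[OF holo_map_on_frechet(1)[OF F]] .
  have "inj ?D" using det det_nz_iff_inj_gen[OF holo_map_on_frechet_linear[OF F]] by (simp add: jacobian_def)
  then obtain E where E: "linear E" "\<And>v. E (?D v) = v" "\<And>v. ?D (E v) = v"
    using linear_injective_isomorphism[OF D] by blast
  show ?thesis
  proof (intro exI[of _ E] conjI allI)
    show "bounded_linear E" using E(1) linear_conv_bounded_linear by blast
    \<comment> \<open>The inverse comes as a real-linear map. It inherits complex linearity because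
      the derivative sends \<open>c *s E v\<close> to \<open>c *s v\<close>.\<close>
    show "E (c *s v) = c *s E v" for c v
      using E(2)[of "c *s E v"] by (simp add: holo_map_on_frechet(2)[OF F] E(3))
  qed (rule E(2))
qed

lemma holo_map_on_local_homeomorphism:
  fixes F :: "complex^'n \<Rightarrow> complex^'n"
  assumes U: "open U" and F: "holo_map_on F U" and x: "x \<in> U" and det: "det (jacobian F (at x)) \<noteq> 0"
  obtains V g where "open V" "x \<in> V" "V \<subseteq> U" "open (F ` V)" "homeomorphism V (F ` V) F g"
proof -
  define f' where "f' z = Blinfun (frechet_derivative F (at z))" for z
  have f': "blinfun_apply (f' z) = frechet_derivative F (at z)" if "z \<in> U" for z
    unfolding f'_def
    by (rule bounded_linear_Blinfun_apply) (rule has_derivative_bounded_linear[OF holo_map_on_frechet(1)[OF F that]])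
  obtain E where E: "bounded_linear E" "\<And>c v. E (c *s v) = c *s E v"
    "\<And>v. E (frechet_derivative F (at x) v) = v"
    using frechet_derivative_left_inverse[OF F x det] by (elim exE conjE) simp
  \<comment> \<open>The inverse function theorem wants the derivative continuous in the operator
    norm. In finite dimension continuity at each fixed vector suffices, and that is continuity of
    the directional derivatives.\<close>
  have cont: "continuous_on U f'"
  proof (rule continuous_on_blinfun_componentwise)
    fix b :: "complex^'n"
    have "continuous_on U (\<lambda>z. \<chi> i. frechet_derivative (\<lambda>z. F z $ i) (at z) b)"
      by (intro continuous_on_vec_lambda)
        (use holo_on_lines_directional_derivative[OF U holo_map_on_component(1)[OF F]] in \<open>auto simp: holo_on_lines_def\<close>)
    then show "continuous_on U (\<lambda>z. blinfun_apply (f' z) b)"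
      by (rule continuous_on_eq) (simp add: f' vec_eq_iff holo_map_on_component(2)[OF F])
  qed
  have "Blinfun E o\<^sub>L f' x = id_blinfun"
    by (rule blinfun_eqI) (simp add: f'[OF x] bounded_linear_Blinfun_apply[OF E(1)] E(3))
  from inverse_function_theorem[where f = F and invf = "Blinfun E", OF U _ cont x this]
  obtain V W g where V: "open V" "V \<subseteq> U" "x \<in> V" "open W" "homeomorphism V W F g"
    using f' holo_map_on_frechet(1)[OF F] by (metis (no_types, lifting))
  then have "W = F ` V" by (simp add: homeomorphism_def)
  then show ?thesis using that V by blast
qed

text \<open>A continuous right inverse of a map with invertible derivatives is differentiable, and
  its derivative is the inverse of a complex-linear map.\<close>

lemma holo_map_on_inverse:
  fixes F G :: "complex^'n \<Rightarrow> complex^'n"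
  assumes F: "holo_map_on F U" and det: "\<And>x. x \<in> U \<Longrightarrow> det (jacobian F (at x)) \<noteq> 0"
    and V: "open V" and G: "continuous_on V G" "\<And>y. y \<in> V \<Longrightarrow> G y \<in> U" "\<And>y. y \<in> V \<Longrightarrow> F (G y) = y"
  shows "holo_map_on G V"
  unfolding holo_map_on_def
proof
  fix y assume y: "y \<in> V"
  obtain E where E: "bounded_linear E" "\<And>c v. E (c *s v) = c *s E v"
    "\<And>v. E (frechet_derivative F (at (G y)) v) = v"
    using frechet_derivative_left_inverse[OF F G(2)[OF y] det[OF G(2)[OF y]]] by (elim exE conjE) simp
  have "(G has_derivative E) (at y)"
    by (rule has_derivative_inverse_basic[OF holo_map_on_frechet(1)[OF F G(2)[OF y]] E(1) _ _ V y G(3)])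
      (use E(3) continuous_on_eq_continuous_at[OF V] G(1) y in \<open>auto simp: fun_eq_iff\<close>)
  then show "\<exists>D. (G has_derivative D) (at y) \<and> (\<forall>c v. D (c *s v) = c *s D v)" using E(2) by blast
qed

text \<open>
  Sard's theorem in the library is about \<open>real^'m\<close> with a well-ordered index type, hence the
  passage to \<open>real^'n bit0\<close>, whose index type has twice as many elements.
\<close>

lemma exists_nonsingular_point:
  fixes F :: "'i \<Rightarrow> complex^'n \<Rightarrow> complex^'n"
  assumes I: "countable I" and F: "\<And>i. i \<in> I \<Longrightarrow> holo_map_on (F i) (U i)"
    and Q: "open Q" "Q \<noteq> {}" "Q \<subseteq> (\<Union>i\<in>I. F i ` U i)"
  shows "\<exists>i\<in>I. \<exists>x\<in>U i. det (jacobian (F i) (at x)) \<noteq> 0"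
proof (rule ccontr)
  assume "\<not> ?thesis"
  then have det0: "\<And>i x. i \<in> I \<Longrightarrow> x \<in> U i \<Longrightarrow> det (jacobian (F i) (at x)) = 0" by blast
  have "DIM(complex^'n) = DIM(real^'n bit0)" by (simp add: card_bit0)
  then obtain L :: "complex^'n \<Rightarrow> real^'n bit0" and L'
    where L: "linear L" "linear L'" "\<And>x. L' (L x) = x" "\<And>y. L (L' y) = y"
    by (rule isomorphisms_UNIV_UNIV) blast
  have Lb: "bounded_linear L" "bounded_linear L'" using L linear_conv_bounded_linear by blast+
  have "negligible ((L \<circ> F i \<circ> L') ` (L ` U i))" if i: "i \<in> I" for i
  proof (rule baby_Sard)
    fix y assume "y \<in> L ` U i"
    then obtain x where x: "x \<in> U i" "y = L x" by blast
    let ?D = "frechet_derivative (F i) (at (L' y))"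
    have L'y: "L' y \<in> U i" using x L by simp
    have D: "(F i has_derivative ?D) (at (L' y))" by (rule holo_map_on_frechet(1)[OF F[OF i] L'y])
    have "(L \<circ> (F i \<circ> L') has_derivative L \<circ> (?D \<circ> L')) (at y)"
      by (intro diff_chain_at D bounded_linear_imp_has_derivative Lb)
    then show "(L \<circ> F i \<circ> L' has_derivative L \<circ> ?D \<circ> L') (at y within L ` U i)"
      by (simp add: comp_assoc has_derivative_at_withinI)
    have lin: "linear (L \<circ> ?D \<circ> L')"
      using L has_derivative_linear[OF D] by (intro linear_compose)
    \<comment> \<open>A vanishing complex determinant means a kernel, and the kernel survives the
      change to real coordinates, where it forces the rank deficiency that Sard's theorem asks
      for.\<close>
    have "\<not> inj ?D"
      using det0[OF i L'y] det_nz_iff_inj_gen[OF holo_map_on_frechet_linear[OF F[OF i] L'y]]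
      by (simp add: jacobian_def)
    then have "\<not> inj (L \<circ> ?D \<circ> L')"
      using L(3) unfolding inj_def comp_def by metis
    then have "rank (matrix (L \<circ> ?D \<circ> L')) \<noteq> CARD('n bit0)"
      using full_rank_injective[of "matrix (L \<circ> ?D \<circ> L')"] matrix_vector_mul(2)[OF lin] by simp
    then show "rank (matrix (L \<circ> ?D \<circ> L')) < CARD('n bit0)"
      using rank_bound[of "matrix (L \<circ> ?D \<circ> L')"] by simp
  qed simp
  then have "negligible (\<Union>i\<in>I. L ` F i ` U i)"
    using L(3) I by (intro negligible_countable_Union) (auto simp: image_comp comp_def)
  moreover have "L ` Q \<subseteq> (\<Union>i\<in>I. L ` F i ` U i)" using Q(3) by blast
  ultimately have "negligible (L ` Q)" using negligible_subset by blast
  moreover have "surj L" using L(4) by (metis surjI)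
  then have "open (L ` Q)" using open_surjective_linear_image[OF Q(1) L(1)] by blast
  ultimately show False using open_not_negligible Q(2) by blast
qed

section \<open>Complex manifolds\<close>

lemma complex_atlas_chart:
  assumes A: "complex_atlas A" and a: "a \<in> A"
  shows complex_atlas_open: "open (fst a)"
    and complex_atlas_open_image: "open (snd a ` fst a)"
    and complex_atlas_homeomorphism: "homeomorphism (fst a) (snd a ` fst a) (snd a) (chart_inv a)"
proof -
  have "case a of (U, \<phi>) \<Rightarrow> open U \<and> open (\<phi> ` U) \<and> homeomorphism U (\<phi> ` U) \<phi> (chart_inv (U, \<phi>))"
    using A a unfolding complex_atlas_def by blast
  then show "open (fst a)" "open (snd a ` fst a)" "homeomorphism (fst a) (snd a ` fst a) (snd a) (chart_inv a)"
    by (simp_all add: case_prod_beta)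
qed

lemma complex_atlas_cover: "complex_atlas A \<Longrightarrow> \<exists>a\<in>A. p \<in> fst a"
  using UNIV_I[of p] unfolding complex_atlas_def case_prod_beta by blast

lemma chart_inv_apply: "complex_atlas A \<Longrightarrow> a \<in> A \<Longrightarrow> q \<in> fst a \<Longrightarrow> chart_inv a (snd a q) = q"
  using complex_atlas_homeomorphism homeomorphism_apply1 by metis

lemma continuous_on_chart: "complex_atlas A \<Longrightarrow> a \<in> A \<Longrightarrow> continuous_on (fst a) (snd a)"
  using complex_atlas_homeomorphism homeomorphism_cont1 by metis

lemma continuous_on_chart_inv:
  "complex_atlas A \<Longrightarrow> a \<in> A \<Longrightarrow> continuous_on (snd a ` fst a) (chart_inv a)"
  using complex_atlas_homeomorphism homeomorphism_cont2 by metis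

lemma open_chart_image:
  assumes A: "complex_atlas A" "a \<in> A" and W: "open W"
  shows "open (snd a ` (fst a \<inter> W))"
  using homeomorphism_imp_open_map[OF complex_atlas_homeomorphism[OF A], of "fst a \<inter> W"]
    openin_open_trans complex_atlas_open_image[OF A] W by (auto simp: openin_open_Int)

lemma open_chart_vimage:
  assumes A: "complex_atlas A" "a \<in> A" and V: "open V"
  shows "open (fst a \<inter> snd a -` V)"
  using continuous_open_preimage[OF continuous_on_chart[OF A] complex_atlas_open[OF A] V] .

lemma holo_map_on_transition:
  "complex_atlas A \<Longrightarrow> a \<in> A \<Longrightarrow> b \<in> A \<Longrightarrow> holo_map_on (snd b \<circ> chart_inv a) (snd a ` (fst a \<inter> fst b))"
  unfolding complex_atlas_def case_prod_beta by simp

text \<open>Images of coordinate balls are path-connected neighbourhoods, so path components and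
  their complements are open.\<close>

lemma complex_atlas_path_connected:
  fixes A :: "('a::{t2_space, second_countable_topology}, 'n::finite) chart set"
  assumes A: "complex_atlas A" and conn: "connected (UNIV :: 'a set)"
  shows "path_connected (UNIV :: 'a set)"
proof -
  have nbhd: "\<exists>W. open W \<and> y \<in> W \<and> path_connected W" for y :: 'a
  proof -
    obtain a where a: "a \<in> A" "y \<in> fst a" using complex_atlas_cover[OF A] by blast
    obtain r where r: "r > 0" "ball (snd a y) r \<subseteq> snd a ` fst a"
      using complex_atlas_open_image[OF A a(1)] a(2) open_contains_ball by (metis imageI)
    have W: "fst a \<inter> snd a -` ball (snd a y) r = chart_inv a ` ball (snd a y) r"
      using r(2) chart_inv_apply[OF A a(1)] by (force simp: image_iff subset_iff)
    have "path_connected (chart_inv a ` ball (snd a y) r)"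
      by (intro path_connected_continuous_image continuous_on_subset[OF continuous_on_chart_inv[OF A a(1)]]
          r convex_imp_path_connected convex_ball)
    then show ?thesis
      using open_chart_vimage[OF A a(1) open_ball, of "snd a y" r] a(2) r(1) W by (metis Int_iff vimageI centre_in_ball)
  qed
  show ?thesis
    unfolding path_connected_component
  proof (intro ballI)
    fix x y :: 'a
    let ?C = "{z. path_component UNIV x z}"
    have eq: "path_component UNIV x z \<longleftrightarrow> path_component UNIV x z'"
      if "z \<in> W" "z' \<in> W" "path_connected W" for z z' W
    proof -
      have "path_component UNIV z z'"
        using that path_component_of_subset unfolding path_connected_component by blast
      then show ?thesis using path_component_trans path_component_sym by metis
    qed
    have 1: "open ?C"
      by (subst open_subopen, intro ballI) (metis nbhd eq mem_Collect_eq subsetI)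
    have 2: "open (- ?C)"
      by (subst open_subopen, intro ballI) (metis nbhd eq mem_Collect_eq subsetI ComplD ComplI)
    have "x \<in> ?C" by (simp add: path_component_refl)
    then have "- ?C = {}" using connectedD[OF conn 1 2] by blast
    then show "path_component UNIV x y" by blast
  qed
qed

section \<open>Embedding into a normed space and injectivity of local homeomorphisms\<close>

text \<open>\<open>e\<close> pairs a cut-off \<open>\<beta>\<close> with \<open>\<beta>\<close>
  times the coordinates. Where the cut-off is nonzero, the coordinates are the quotient of the two,
  so \<open>e\<close> separates such a point from all others.\<close>

lemma chart_bump_function:
  fixes A :: "('a::{t2_space, second_countable_topology}, 'n::finite) chart set"
  assumes A: "complex_atlas A"
  shows "\<exists>e :: 'a \<Rightarrow> real \<times> (complex^'n). continuous_on UNIV e \<and> fst (e p) \<noteq> 0 \<and>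
    (\<forall>q q'. fst (e q) \<noteq> 0 \<longrightarrow> e q = e q' \<longrightarrow> q = q')"
proof -
  obtain a where a: "a \<in> A" "p \<in> fst a" using complex_atlas_cover[OF A] by blast
  obtain r where r: "r > 0" "cball (snd a p) r \<subseteq> snd a ` fst a"
    using complex_atlas_open_image[OF A a(1)] a(2) open_contains_cball by (metis imageI)
  define \<beta> where "\<beta> q = max 0 (1 - dist (snd a p) (snd a q) / r)" for q
  define e where "e q = (if q \<in> fst a then (\<beta> q, \<beta> q *\<^sub>R snd a q) else 0)" for q
  \<comment> \<open>\<open>K\<close> is compact, hence closed, and \<open>e\<close> vanishes off it.
    So \<open>e\<close> is continuous on the two open sets \<open>fst a\<close> and
    \<open>- K\<close>, which cover the space.\<close>
  define K where "K = chart_inv a ` cball (snd a p) r"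
  have "compact K" unfolding K_def
    by (intro compact_continuous_image continuous_on_subset[OF continuous_on_chart_inv[OF A a(1)]] r compact_cball)
  then have K: "open (- K)" by (simp add: compact_imp_closed open_Compl)
  have KU: "K \<subseteq> fst a" unfolding K_def using r(2) chart_inv_apply[OF A a(1)] by force
  have e0: "e q = 0" if "q \<in> - K" for q
  proof (cases "q \<in> fst a")
    case True
    then have "snd a q \<notin> cball (snd a p) r" using that chart_inv_apply[OF A a(1)] unfolding K_def by force
    then show ?thesis using r(1) by (auto simp: e_def \<beta>_def max_def field_simps zero_prod_def)
  qed (simp add: e_def)
  have "continuous_on (fst a) (\<lambda>q. (\<beta> q, \<beta> q *\<^sub>R snd a q))"
    unfolding \<beta>_def using r(1) by (intro continuous_intros continuous_on_chart[OF A a(1)]) auto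
  then have c1: "continuous_on (fst a) e" by (rule continuous_on_eq) (simp add: e_def)
  have c2: "continuous_on (- K) e" by (rule continuous_on_eq[OF continuous_on_const[of _ 0]]) (simp add: e0)
  have "fst a \<union> - K = UNIV" using KU by blast
  then have "continuous_on UNIV e"
    using continuous_on_open_Un[OF complex_atlas_open[OF A a(1)] K c1 c2] by simp
  moreover have "fst (e p) \<noteq> 0" using a(2) by (simp add: e_def \<beta>_def)
  moreover have "q = q'" if "fst (e q) \<noteq> 0" "e q = e q'" for q q'
  proof -
    have *: "q \<in> fst a" "q' \<in> fst a" "\<beta> q = \<beta> q'" "\<beta> q \<noteq> 0" "\<beta> q *\<^sub>R snd a q = \<beta> q' *\<^sub>R snd a q'"
      using that by (auto simp: e_def zero_prod_def split: if_splits)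
    then have "snd a q = snd a q'" by simp
    then show ?thesis using *(1,2) chart_inv_apply[OF A a(1)] by metis
  qed
  ultimately show ?thesis by (intro exI[of _ e] conjI allI impI) assumption+
qed

text \<open>
  The lifting theorems for covering spaces in the library are about subsets of normed spaces.
  As the number of charts is not bounded by a type, the bump functions of a finite cover are
  assembled to a map into a space of bounded sequences.
\<close>

lemma complex_atlas_embedding:
  fixes A :: "('a::{t2_space, second_countable_topology}, 'n::finite) chart set"
  assumes A: "complex_atlas A" and compact: "compact (UNIV :: 'a set)"
  shows "\<exists>E :: 'a \<Rightarrow> (nat \<Rightarrow>\<^sub>C (real \<times> (complex^'n))). continuous_on UNIV E \<and> inj E"
proof -
  obtain e :: "'a \<Rightarrow> 'a \<Rightarrow> real \<times> (complex^'n)" where e: "\<And>p. continuous_on UNIV (e p)" "\<And>p. fst (e p p) \<noteq> 0"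
    "\<And>p q q'. fst (e p q) \<noteq> 0 \<Longrightarrow> e p q = e p q' \<Longrightarrow> q = q'"
    using chart_bump_function[OF A] by metis
  have "open {q. fst (e p q) \<noteq> 0}" for p
    by (intro open_Collect_neq continuous_intros e(1))
  moreover have "UNIV \<subseteq> (\<Union>p\<in>UNIV. {q. fst (e p q) \<noteq> 0})" using e(2) by auto
  ultimately obtain C where C: "finite C" "UNIV \<subseteq> (\<Union>p\<in>C. {q. fst (e p q) \<noteq> 0})"
    by (rule compactE_image[OF compact, where C = UNIV]) simp_all
  obtain c and k :: nat where c: "C = c ` {..<k}"
    using finite_imp_nat_seg_image_inj_on[OF C(1)] by (metis lessThan_def)
  define E where "E q = Bcontfun (\<lambda>i. if i < k then e (c i) q else 0)" for q
  have E: "apply_bcontfun (E q) = (\<lambda>i. if i < k then e (c i) q else 0)" for q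
  proof -
    have "range (\<lambda>i. if i < k then e (c i) q else 0) \<subseteq> insert 0 ((\<lambda>i. e (c i) q) ` {..<k})" by auto
    then have "finite (range (\<lambda>i. if i < k then e (c i) q else 0))" by (rule finite_subset) simp
    then have "(\<lambda>i. if i < k then e (c i) q else 0) \<in> bcontfun"
      by (auto simp: bcontfun_def finite_imp_bounded)
    then show ?thesis unfolding E_def by (rule Bcontfun_inverse)
  qed
  have "continuous_on UNIV E"
    unfolding continuous_on_def
  proof (intro ballI tendstoI)
    fix q :: 'a and \<epsilon> :: real assume \<epsilon>: "\<epsilon> > 0"
    have "\<forall>\<^sub>F q' in at q. dist (e (c i) q') (e (c i) q) < \<epsilon>/2" for i
      using e(1)[of "c i"] \<epsilon> unfolding continuous_on_def by (intro tendstoD) auto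
    then have "\<forall>\<^sub>F q' in at q. \<forall>i\<in>{..<k}. dist (e (c i) q') (e (c i) q) < \<epsilon>/2"
      by (intro eventually_ball_finite) auto
    then have "\<forall>\<^sub>F q' in at q. dist (E q') (E q) < \<epsilon>"
    proof eventually_elim
      case (elim q')
      have "dist (E q') (E q) \<le> \<epsilon>/2"
        by (rule dist_bound) (use elim \<epsilon> in \<open>auto simp: E less_imp_le\<close>)
      then show ?case using \<epsilon> by simp
    qed
    then show "\<forall>\<^sub>F q' in at q within UNIV. dist (E q') (E q) < \<epsilon>" by simp
  qed
  moreover have "inj E"
  proof (rule injI)
    fix q q' assume eq: "E q = E q'"
    have "q \<in> (\<Union>p\<in>C. {q. fst (e p q) \<noteq> 0})" by (rule subsetD[OF C(2) UNIV_I])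
    then obtain i where i: "i < k" "fst (e (c i) q) \<noteq> 0" unfolding c by auto
    have "e (c i) q = e (c i) q'" using arg_cong[OF eq, of "\<lambda>E. apply_bcontfun E i"] i by (simp add: E)
    then show "q = q'" by (rule e(3)[OF i(2)])
  qed
  ultimately show ?thesis by (intro exI conjI)
qed

text \<open>Everything is transported along an embedding, which is a homeomorphism onto its image
  \<open>S\<close> by compactness. The covering results then apply to the conjugate \<open>F\<close>
  of \<open>f\<close>.\<close>

lemma inj_local_homeomorphism_finite_fundamental_group:
  fixes A :: "('a::{t2_space, second_countable_topology}, 'n::finite) chart set" and f :: "'a \<Rightarrow> 'a"
  assumes A: "complex_atlas A" and compact: "compact (UNIV :: 'a set)" and conn: "connected (UNIV :: 'a set)"
    and fin: "\<And>x::'a. finite (carrier (fundamental_group x))"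
    and f: "continuous_on UNIV f" "surj f"
    and loc: "\<And>x::'a. \<exists>U g. x \<in> U \<and> open U \<and> open (f ` U) \<and> homeomorphism U (f ` U) f g"
  shows "inj f"
proof -
  obtain E :: "'a \<Rightarrow> (nat \<Rightarrow>\<^sub>C (real \<times> (complex^'n)))" where E: "continuous_on UNIV E" "inj E"
    using complex_atlas_embedding[OF A compact] by blast
  define S where "S = range E"
  obtain R where R: "homeomorphism UNIV S E R"
    using homeomorphism_compact[OF compact E(1) _ E(2), of S] S_def by blast
  have RE: "R (E x) = x" for x using R by (simp add: homeomorphism_def)
  have ER: "E (R y) = y" if "y \<in> S" for y using R that by (simp add: homeomorphism_def)
  have contR: "continuous_on S R" using R by (simp add: homeomorphism_def)
  have ES: "E x \<in> S" for x by (simp add: S_def)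
  define F where "F = E \<circ> f \<circ> R"
  have cov: "covering_space S F S"
  proof (rule compact_local_homeomorphism_covering_space)
    show "compact S" unfolding S_def by (rule compact_continuous_image[OF E(1) compact])
    have "continuous_on (range f) E" using E(1) continuous_on_subset by blast
    then show "continuous_on S F"
      unfolding F_def comp_assoc
      by (intro continuous_on_compose contR continuous_on_subset[OF f(1)] continuous_on_subset[OF E(1)]) auto
    have "R ` S = UNIV" using R by (simp add: homeomorphism_def)
    then show "F ` S = S" by (simp only: F_def image_comp[symmetric] f(2) S_def)
  next
    fix y assume y: "y \<in> S"
    obtain U g where U: "R y \<in> U" "open U" "open (f ` U)" "homeomorphism U (f ` U) f g" using loc by blast
    have im: "openin (top_of_set S) (E ` W)" if "open W" for W
      using homeomorphism_imp_open_map[OF R, of W] that by simp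
    have FU: "F ` E ` U = E ` f ` U" by (auto simp: F_def RE image_image)
    have 1: "homeomorphism (E ` U) U R E"
      by (rule homeomorphism_of_subsets[OF homeomorphism_symD[OF R]]) (auto simp: S_def RE image_image)
    have 2: "homeomorphism (f ` U) (E ` f ` U) E R"
      by (rule homeomorphism_of_subsets[OF R]) auto
    have "homeomorphism (E ` U) (F ` E ` U) F (E \<circ> (g \<circ> R))"
      unfolding F_def comp_assoc
      using homeomorphism_compose[OF 1 homeomorphism_compose[OF U(4) 2]] FU
      by (simp add: F_def comp_assoc)
    moreover have "y \<in> E ` U" using ER[OF y] U(1) by (metis imageI)
    ultimately show "\<exists>U g. y \<in> U \<and> openin (top_of_set S) U \<and> openin (top_of_set S) (F ` U) \<and> homeomorphism U (F ` U) F g"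
      using im U(2,3) FU by metis
  qed
  have "path_connected S"
    unfolding S_def by (rule path_connected_continuous_image[OF E(1) complex_atlas_path_connected[OF A conn]])
  moreover have "finite ((\<lambda>p. {q. homotopic_paths S p q}) `
      {p. path p \<and> path_image p \<subseteq> S \<and> pathstart p = x \<and> pathfinish p = x})" (is "finite (?cls ` ?L)") for x
  proof -
    \<comment> \<open>\<open>\<Theta>\<close> takes a loop class of the manifold back to
      \<open>S\<close>. Every class of loops in \<open>S\<close> at \<open>x\<close> arises in this
      way from one of the finitely many classes at \<open>R x\<close>.\<close>
    define \<Theta> where "\<Theta> P = {q. path q \<and> path_image q \<subseteq> S \<and> R \<circ> q \<in> P}" for P
    have cls: "?cls p = \<Theta> (loop_class (R \<circ> p))" "R \<circ> p \<in> loops_at (R x)" if p: "p \<in> ?L" for p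
    proof -
      have eq: "homotopic_paths S (E \<circ> (R \<circ> q)) q" if "path q" "path_image q \<subseteq> S" for q
        by (rule homotopic_paths_sym[OF homotopic_paths_eq])
          (use that ER in \<open>auto simp: path_image_def image_subset_iff\<close>)
      have 1: "homotopic_paths UNIV (R \<circ> p) (R \<circ> q)" if "homotopic_paths S p q" for q
        by (rule homotopic_paths_continuous_image[OF that contR]) simp
      have 2: "homotopic_paths S p q" if q: "path q" "path_image q \<subseteq> S" "homotopic_paths UNIV (R \<circ> p) (R \<circ> q)" for q
      proof -
        have "homotopic_paths S (E \<circ> (R \<circ> p)) (E \<circ> (R \<circ> q))"
          by (rule homotopic_paths_continuous_image[OF q(3) E(1)]) (simp add: S_def)
        then show ?thesis using eq[of p] eq[OF q(1,2)] p homotopic_paths_trans homotopic_paths_sym by blast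
      qed
      show "?cls p = \<Theta> (loop_class (R \<circ> p))"
        unfolding \<Theta>_def loop_class_def
        using 1 2 homotopic_paths_imp_path homotopic_paths_imp_subset by blast
      show "R \<circ> p \<in> loops_at (R x)"
        using p by (auto simp: loops_at_def pathstart_compose pathfinish_compose
            intro!: path_continuous_image continuous_on_subset[OF contR])
    qed
    have "?cls ` ?L \<subseteq> \<Theta> ` loop_class ` loops_at (R x)" using cls by (auto intro!: imageI)
    moreover have "finite (loop_class ` loops_at (R x))" using fin[of "R x"] by (simp add: fundamental_group_def)
    ultimately show ?thesis using finite_subset by blast
  qed
  ultimately have inj: "inj_on F S" using covering_space_self_inj_on[OF cov] by blast
  show "inj f"
  proof (rule injI)
    fix x y assume "f x = f y"
    then have "F (E x) = F (E y)" by (simp add: F_def RE)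
    then show "x = y" using inj ES E(2) by (metis inj_onD injD)
  qed
qed

text \<open>The set where the modulus attains its maximum is closed by continuity and open by the
  maximum principle in a chart.\<close>

lemma constant_modulus:
  fixes A :: "('a::{t2_space, second_countable_topology}, 'n::finite) chart set"
  assumes A: "complex_atlas A" and compact: "compact (UNIV :: 'a set)" and conn: "connected (UNIV :: 'a set)"
    and h: "\<And>p::'a. \<exists>a\<in>A. \<exists>W. open W \<and> p \<in> W \<and> W \<subseteq> fst a \<and> holo_on_lines (h \<circ> chart_inv a) (snd a ` W)"
  shows "cmod (h p) = cmod (h q)"
proof -
  have cont: "isCont h p" for p
  proof -
    obtain a W where W: "a \<in> A" "open W" "p \<in> W" "W \<subseteq> fst a" "holo_on_lines (h \<circ> chart_inv a) (snd a ` W)"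
      using h by blast
    have "continuous_on W ((h \<circ> chart_inv a) \<circ> snd a)"
      using continuous_on_subset[OF continuous_on_chart[OF A W(1)] W(4)] W(5)
      unfolding holo_on_lines_def by (blast intro: continuous_on_compose)
    then have "continuous_on W h"
      by (rule continuous_on_eq) (use W(4) chart_inv_apply[OF A W(1)] in auto)
    then show ?thesis using W continuous_on_eq_continuous_at by blast
  qed
  have contn: "continuous_on UNIV (\<lambda>p. cmod (h p))"
    using cont by (intro continuous_intros) (simp add: continuous_on_eq_continuous_at)
  then obtain p0 where p0: "\<And>p. cmod (h p) \<le> cmod (h p0)"
    using continuous_attains_sup[OF compact, of "\<lambda>p. cmod (h p)"] by auto
  have cl: "closed {p. cmod (h p) = cmod (h p0)}"
    by (rule closed_Collect_eq[OF contn continuous_on_const])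
  have op: "open {p. cmod (h p) = cmod (h p0)}" (is "open ?M")
  proof (subst open_subopen, intro ballI)
    fix p assume p: "p \<in> ?M"
    obtain a W where W: "a \<in> A" "open W" "p \<in> W" "W \<subseteq> fst a" "holo_on_lines (h \<circ> chart_inv a) (snd a ` W)"
      using h by blast
    have "open (snd a ` W)" using open_chart_image[OF A W(1,2)] W(4) by (simp add: Int_absorb1)
    then obtain r where r: "r > 0" "ball (snd a p) r \<subseteq> snd a ` W"
      using W(3) open_contains_ball by blast
    define V where "V = fst a \<inter> snd a -` ball (snd a p) r"
    have "open V" unfolding V_def by (rule open_chart_vimage[OF A W(1) open_ball])
    moreover have "p \<in> V" using W r by (auto simp: V_def)
    moreover have "V \<subseteq> ?M"
    proof
      fix q assume q: "q \<in> V"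
      have "cmod ((h \<circ> chart_inv a) (snd a q)) = cmod ((h \<circ> chart_inv a) (snd a p))"
        by (rule holo_on_lines_maximum_modulus[OF W(5) r(2)])
          (use q p p0 W chart_inv_apply[OF A W(1)] in \<open>auto simp: V_def\<close>)
      then show "q \<in> ?M" using p q W chart_inv_apply[OF A W(1)] by (auto simp: V_def)
    qed
    ultimately show "\<exists>T. open T \<and> p \<in> T \<and> T \<subseteq> ?M" by blast
  qed
  have "- ?M \<inter> UNIV = {}"
    using connectedD[OF conn op, of "- ?M"] cl by (auto simp: open_Compl)
  then have eq: "cmod (h x) = cmod (h p0)" for x by blast
  show ?thesis using eq[of p] eq[of q] by simp
qed

section \<open>The Jacobian determinant of a holomorphic self-map\<close>

text \<open>For \<open>p\<close> in \<open>fst a\<close> and \<open>f p\<close> in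
  \<open>fst b\<close> this is the coefficient of the pullback under \<open>f\<close> of the frame
  of top forms over \<open>b\<close>, with respect to the frame over \<open>a\<close>.\<close>

definition chart_jacobian :: "('a \<Rightarrow> 'a) \<Rightarrow> ('a, 'n::finite) chart \<Rightarrow> ('a, 'n) chart \<Rightarrow> 'a \<Rightarrow> complex" where
  "chart_jacobian f a b p = det (jacobian (snd b \<circ> f \<circ> chart_inv a) (at (snd a p)))"

lemma holomorphic_map_local:
  "holomorphic_map A B f \<Longrightarrow> a \<in> A \<Longrightarrow> b \<in> B \<Longrightarrow>
    holo_map_on (snd b \<circ> f \<circ> chart_inv a) (snd a ` (fst a \<inter> f -` fst b))"
  unfolding holomorphic_map_def case_prod_beta by simp

lemma holomorphic_map_continuous: "holomorphic_map A B f \<Longrightarrow> continuous_on UNIV f"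
  by (simp add: holomorphic_map_def)

text \<open>The chain rule turns a change of chart on either side into a transition factor of the
  canonical bundle, at \<open>f p\<close> for the target and at \<open>p\<close> for the source.
  These factors cancel in the quotient of sections formed later.\<close>

lemma chart_jacobian_change:
  fixes A :: "('a::{t2_space, second_countable_topology}, 'n::finite) chart set"
  assumes A: "complex_atlas A" and f: "holomorphic_map A A f"
    and a: "a \<in> A" "a' \<in> A" "p \<in> fst a" "p \<in> fst a'" and b: "b \<in> A" "b' \<in> A" "f p \<in> fst b" "f p \<in> fst b'"
  shows chart_jacobian_change_target: "chart_jacobian f a b' p = canonical_bundle b b' (f p) * chart_jacobian f a b p"
    and chart_jacobian_change_source: "chart_jacobian f a b p = chart_jacobian f a' b p * canonical_bundle a a' p"
proof -
  have fo: "open (f -` fst c)" if "c \<in> A" for c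
    by (rule open_vimage[OF complex_atlas_open[OF A that] holomorphic_map_continuous[OF f]])
  note inv = chart_inv_apply[OF A]
  let ?W = "snd a ` (fst a \<inter> (f -` fst b \<inter> f -` fst b'))"
  have "det (jacobian (snd b' \<circ> f \<circ> chart_inv a) (at (snd a p)))
    = det (jacobian (snd b' \<circ> chart_inv b) (at ((snd b \<circ> f \<circ> chart_inv a) (snd a p))))
      * det (jacobian (snd b \<circ> f \<circ> chart_inv a) (at (snd a p)))"
  proof (rule det_jacobian_compose)
    show "holo_map_on (snd b \<circ> f \<circ> chart_inv a) (snd a ` (fst a \<inter> f -` fst b))"
      by (rule holomorphic_map_local[OF f a(1) b(1)])
    show "holo_map_on (snd b' \<circ> chart_inv b) (snd b ` (fst b \<inter> fst b'))"
      by (rule holo_map_on_transition[OF A b(1,2)])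
    show "open ?W" by (rule open_chart_image[OF A a(1)]) (intro open_Int fo b)
  qed (use a b in \<open>auto simp: inv\<close>)
  then show "chart_jacobian f a b' p = canonical_bundle b b' (f p) * chart_jacobian f a b p"
    by (simp add: chart_jacobian_def canonical_bundle_def inv a(1,3))
  let ?W = "snd a ` (fst a \<inter> (fst a' \<inter> f -` fst b))"
  have "det (jacobian (snd b \<circ> f \<circ> chart_inv a) (at (snd a p)))
    = det (jacobian (snd b \<circ> f \<circ> chart_inv a') (at ((snd a' \<circ> chart_inv a) (snd a p))))
      * det (jacobian (snd a' \<circ> chart_inv a) (at (snd a p)))"
  proof (rule det_jacobian_compose)
    show "holo_map_on (snd b \<circ> f \<circ> chart_inv a') (snd a' ` (fst a' \<inter> f -` fst b))"
      by (rule holomorphic_map_local[OF f a(2) b(1)])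
    show "holo_map_on (snd a' \<circ> chart_inv a) (snd a ` (fst a \<inter> fst a'))"
      by (rule holo_map_on_transition[OF A a(1,2)])
    show "open ?W" by (rule open_chart_image[OF A a(1)]) (intro open_Int fo b complex_atlas_open[OF A] a)
  qed (use a b in \<open>auto simp: inv\<close>)
  then show "chart_jacobian f a b p = chart_jacobian f a' b p * canonical_bundle a a' p"
    by (simp add: chart_jacobian_def canonical_bundle_def inv a(1,3))
qed

text \<open>Since \<open>f\<close> is onto, its coordinate expressions into one chart cover the open
  image of that chart. Compactness leaves finitely many of them, so not all their points can be
  singular.\<close>

lemma exists_nonsingular_chart_jacobian:
  fixes A :: "('a::{t2_space, second_countable_topology}, 'n::finite) chart set"
  assumes A: "complex_atlas A" and compact: "compact (UNIV :: 'a set)"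
    and f: "holomorphic_map A A f" and surj: "surj f"
  shows "\<exists>a\<in>A. \<exists>b\<in>A. \<exists>p. p \<in> fst a \<and> f p \<in> fst b \<and> chart_jacobian f a b p \<noteq> 0"
proof -
  \<comment> \<open>\<open>undefined\<close> is just some point, so that the chart around it is
    nonempty.\<close>
  obtain b where b: "b \<in> A" "undefined \<in> fst b" using complex_atlas_cover[OF A] by blast
  have cover: "UNIV \<subseteq> (\<Union>a\<in>A. fst a)" using complex_atlas_cover[OF A] by blast
  obtain A' where A': "A' \<subseteq> A" "finite A'" "UNIV \<subseteq> (\<Union>a\<in>A'. fst a)"
    by (rule compactE_image[OF compact complex_atlas_open[OF A] cover])
  have "\<exists>a\<in>A'. \<exists>x\<in>snd a ` (fst a \<inter> f -` fst b). det (jacobian (snd b \<circ> f \<circ> chart_inv a) (at x)) \<noteq> 0"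
  proof (rule exists_nonsingular_point)
    show "countable A'" using A'(2) by (rule countable_finite)
    show "holo_map_on (snd b \<circ> f \<circ> chart_inv a) (snd a ` (fst a \<inter> f -` fst b))" if "a \<in> A'" for a
      using holomorphic_map_local[OF f _ b(1)] that A'(1) by blast
    show "open (snd b ` fst b)" by (rule complex_atlas_open_image[OF A b(1)])
    show "snd b ` fst b \<noteq> {}" using b(2) by blast
    show "snd b ` fst b \<subseteq> (\<Union>a\<in>A'. (snd b \<circ> f \<circ> chart_inv a) ` snd a ` (fst a \<inter> f -` fst b))"
    proof (intro subsetI, elim imageE)
      fix y q assume y: "y = snd b q" "q \<in> fst b"
      obtain p where p: "q = f p" using surj by (rule surjE)
      obtain a where a: "a \<in> A'" "p \<in> fst a" using subsetD[OF A'(3) UNIV_I, of p] by (rule UN_E)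
      have "y = (snd b \<circ> f \<circ> chart_inv a) (snd a p)" using y p a A'(1) chart_inv_apply[OF A, of a p] by auto
      then show "y \<in> (\<Union>a\<in>A'. (snd b \<circ> f \<circ> chart_inv a) ` snd a ` (fst a \<inter> f -` fst b))"
        using a y(2) p by blast
    qed
  qed
  then show ?thesis using b(1) A'(1) unfolding chart_jacobian_def by blast
qed

text \<open>
  The local functions \<open>s\<close> of the trivialisation define a nowhere vanishing section \<open>\<omega>\<close> of the
  \<open>m\<close>-th power of the canonical bundle, given by \<open>(dz\<^sub>1 \<and> \<dots> \<and> dz\<^sub>n)\<^sup>m / s a\<close> over the chart \<open>a\<close>. The
  quotient of the pullback of \<open>\<omega>\<close> under \<open>f\<close> by \<open>\<omega>\<close> is a holomorphic function on a compact
  connected manifold, so its modulus is constant.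
\<close>

lemma chart_jacobian_nonzero:
  fixes A :: "('a::{t2_space, second_countable_topology}, 'n::finite) chart set"
  assumes A: "complex_atlas A" and compact: "compact (UNIV :: 'a set)" and conn: "connected (UNIV :: 'a set)"
    and m: "m > 0" and triv: "bundle_isomorphic A (tensor_power canonical_bundle m) trivial_bundle"
    and f: "holomorphic_map A A f" and surj: "surj f"
    and ab: "a \<in> A" "b \<in> A" "p \<in> fst a" "f p \<in> fst b"
  shows "chart_jacobian f a b p \<noteq> 0"
proof -
  obtain s where "\<forall>a\<in>A. holomorphic_function_on A (s a) (fst a) \<and> (\<forall>p\<in>fst a. s a p \<noteq> 0)"
    and "\<forall>a\<in>A. \<forall>b\<in>A. \<forall>p\<in>fst a \<inter> fst b.
        s a p * tensor_power canonical_bundle m a b p = trivial_bundle a b p * s b p"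
    using triv unfolding bundle_isomorphic_def by (elim exE conjE)
  then have s: "\<And>a. a \<in> A \<Longrightarrow> holomorphic_function_on A (s a) (fst a)"
    "\<And>a p. a \<in> A \<Longrightarrow> p \<in> fst a \<Longrightarrow> s a p \<noteq> 0"
    "\<And>a b p. a \<in> A \<Longrightarrow> b \<in> A \<Longrightarrow> p \<in> fst a \<Longrightarrow> p \<in> fst b \<Longrightarrow> s a p * canonical_bundle a b p ^ m = s b p"
    by (simp_all add: tensor_power_def trivial_bundle_def)
  have s_holo: "holo_fun_on (s a \<circ> chart_inv a) (snd a ` fst a)" if "a \<in> A" for a
    using s(1)[OF that] that unfolding holomorphic_function_on_def case_prod_beta by fastforce
  note inv = chart_inv_apply[OF A]
  \<comment> \<open>A choice of one chart at each point, so that \<open>h\<close> is defined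
    globally.\<close>
  define c where "c p = (SOME a. a \<in> A \<and> p \<in> fst a)" for p
  have c: "c p \<in> A" "p \<in> fst (c p)" for p
    using someI_ex[of "\<lambda>a. a \<in> A \<and> p \<in> fst a"] complex_atlas_cover[OF A, of p] unfolding c_def by blast+
  define h where "h p = s (c p) p * chart_jacobian f (c p) (c (f p)) p ^ m / s (c (f p)) (f p)" for p
  \<comment> \<open>Independence of the charts: the \<open>m\<close>-th powers of the factors by
    which the Jacobian changes are quotients of values of \<open>s\<close>, by the compatibility of
    the trivialisation.\<close>
  have h: "h p = s a p * chart_jacobian f a b p ^ m / s b (f p)"
    if "a \<in> A" "b \<in> A" "p \<in> fst a" "f p \<in> fst b" for a b p
  proof -
    let ?a = "c p" and ?b = "c (f p)"
    have 1: "chart_jacobian f a ?b p = canonical_bundle b ?b (f p) * chart_jacobian f a b p"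
      by (rule chart_jacobian_change_target[OF A f that(1,1,3,3) that(2) c(1) that(4) c(2)])
    have 2: "chart_jacobian f a ?b p = chart_jacobian f ?a ?b p * canonical_bundle a ?a p"
      by (rule chart_jacobian_change_source[OF A f that(1) c(1) that(3) c(2) c(1) c(1) c(2) c(2)])
    have "s ?a p * chart_jacobian f ?a ?b p ^ m = s a p * chart_jacobian f a ?b p ^ m"
      by (simp add: s(3)[OF that(1) c(1) that(3) c(2), symmetric] 2 power_mult_distrib)
    also have "\<dots> = s a p * chart_jacobian f a b p ^ m * canonical_bundle b ?b (f p) ^ m"
      by (simp add: 1 power_mult_distrib)
    finally have "h p = s a p * chart_jacobian f a b p ^ m * canonical_bundle b ?b (f p) ^ m
        / (s b (f p) * canonical_bundle b ?b (f p) ^ m)"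
      by (simp add: h_def s(3)[OF that(2) c(1) that(4) c(2)])
    \<comment> \<open>Otherwise its \<open>m\<close>-th power, with \<open>m > 0\<close>, would make
      \<open>s\<close> vanish over the chart \<open>?b\<close>.\<close>
    moreover have "canonical_bundle b ?b (f p) \<noteq> 0"
      using s(2)[OF c(1) c(2), of "f p"] s(3)[OF that(2) c(1) that(4) c(2)] m by (auto simp: zero_power)
    ultimately show ?thesis by simp
  qed
  have const: "cmod (h p) = cmod (h q)" for p q
  proof (rule constant_modulus[OF A compact conn])
    fix p
    \<comment> \<open>The chart chosen may jump from point to point. By independence of the charts,
      \<open>h\<close> is computed on all of \<open>?W\<close> with those chosen at \<open>p\<close>
      and \<open>f p\<close>.\<close>
    let ?a = "c p" and ?b = "c (f p)"
    let ?W = "fst ?a \<inter> f -` fst ?b"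
    let ?F = "snd ?b \<circ> f \<circ> chart_inv ?a"
    have oW: "open ?W"
      by (intro open_Int complex_atlas_open[OF A c(1)] open_vimage[OF _ holomorphic_map_continuous[OF f]])
    have F: "holo_map_on ?F (snd ?a ` ?W)" by (rule holomorphic_map_local[OF f c(1) c(1)])
    have oaW: "open (snd ?a ` ?W)"
      by (intro open_chart_image[OF A c(1)] complex_atlas_open[OF A c(1)] open_vimage[OF _ holomorphic_map_continuous[OF f]])
    have "holo_fun_on ((s ?b \<circ> chart_inv ?b) \<circ> ?F) (snd ?a ` ?W)"
      by (rule holo_fun_on_compose[OF F s_holo[OF c(1)]]) (auto simp: inv[OF c(1)])
    then have l3: "holo_on_lines ((s ?b \<circ> chart_inv ?b) \<circ> ?F) (snd ?a ` ?W)" by (rule holo_on_lines_holo_fun)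
    have l1: "holo_on_lines (s ?a \<circ> chart_inv ?a) (snd ?a ` ?W)"
      by (rule holo_on_lines_holo_fun[OF holo_fun_on_subset[OF s_holo[OF c(1)]]]) blast
    have "holo_on_lines (\<lambda>z. (s ?a \<circ> chart_inv ?a) z * det (jacobian ?F (at z)) ^ m
        / ((s ?b \<circ> chart_inv ?b) \<circ> ?F) z) (snd ?a ` ?W)"
      by (intro holo_on_lines_divide holo_on_lines_mult holo_on_lines_power l1 l3
          holo_on_lines_det_jacobian[OF oaW F]) (auto simp: inv[OF c(1)] s(2)[OF c(1)])
    moreover have "(h \<circ> chart_inv ?a) z = (s ?a \<circ> chart_inv ?a) z * det (jacobian ?F (at z)) ^ m
        / ((s ?b \<circ> chart_inv ?b) \<circ> ?F) z" if "z \<in> snd ?a ` ?W" for z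
      using that
    proof (elim imageE)
      fix q assume q: "z = snd ?a q" "q \<in> ?W"
      then have "q \<in> fst ?a" "f q \<in> fst ?b" by auto
      from h[OF c(1) c(1) this] show ?thesis
        using q(2) by (simp add: q(1) inv[OF c(1)] chart_jacobian_def)
    qed
    ultimately have "holo_on_lines (h \<circ> chart_inv ?a) (snd ?a ` ?W)"
      by (subst holo_on_lines_cong)
    then show "\<exists>a\<in>A. \<exists>W. open W \<and> p \<in> W \<and> W \<subseteq> fst a \<and> holo_on_lines (h \<circ> chart_inv a) (snd a ` W)"
      by (intro bexI[of _ ?a] exI[of _ ?W] conjI oW c(1)) (use c in auto)
  qed
  obtain a0 b0 p0 where 0: "a0 \<in> A" "b0 \<in> A" "p0 \<in> fst a0" "f p0 \<in> fst b0" "chart_jacobian f a0 b0 p0 \<noteq> 0"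
    using exists_nonsingular_chart_jacobian[OF A compact f surj] by (elim bexE exE conjE)
  have "h p0 \<noteq> 0" using 0(5) s(2) 0 by (simp add: h[OF 0(1-4)])
  \<comment> \<open>A zero of the Jacobian at \<open>p\<close> would be a zero of \<open>h\<close>
    as \<open>m > 0\<close>, but the modulus of \<open>h\<close> has the nonzero value it takes at
    \<open>p0\<close>.\<close>
  then have "h p \<noteq> 0" using const[of p p0] by (metis norm_eq_zero)
  then show ?thesis using h[OF ab] m by auto
qed

section \<open>From nonvanishing Jacobian to biholomorphic maps\<close>

lemma nonsingular_local_homeomorphism:
  fixes A :: "('a::{t2_space, second_countable_topology}, 'n::finite) chart set"
  assumes A: "complex_atlas A" and f: "holomorphic_map A A f"
    and ab: "a \<in> A" "b \<in> A" "p \<in> fst a" "f p \<in> fst b" and J: "chart_jacobian f a b p \<noteq> 0"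
  shows "\<exists>U g. p \<in> U \<and> open U \<and> open (f ` U) \<and> homeomorphism U (f ` U) f g"
proof -
  let ?F = "snd b \<circ> f \<circ> chart_inv a"
  let ?D = "snd a ` (fst a \<inter> f -` fst b)"
  have oD: "open ?D"
    by (intro open_chart_image[OF A ab(1)] complex_atlas_open[OF A ab(2)] open_vimage[OF _ holomorphic_map_continuous[OF f]])
  have F: "holo_map_on ?F ?D" by (rule holomorphic_map_local[OF f ab(1,2)])
  have "snd a p \<in> ?D" using ab by blast
  then obtain V g where V: "open V" "snd a p \<in> V" "V \<subseteq> ?D" "open (?F ` V)" "homeomorphism V (?F ` V) ?F g"
    using holo_map_on_local_homeomorphism[OF oD F] J unfolding chart_jacobian_def by metis
  note inva = chart_inv_apply[OF A ab(1)] and invb = chart_inv_apply[OF A ab(2)]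
  define U where "U = fst a \<inter> snd a -` V"
  have Ub: "f q \<in> fst b" if "q \<in> U" for q
  proof -
    obtain q' where "snd a q = snd a q'" "q' \<in> fst a" "f q' \<in> fst b" using \<open>q \<in> U\<close> V(3) by (auto simp: U_def)
    then show ?thesis using \<open>q \<in> U\<close> inva by (metis U_def IntD1)
  qed
  have UV: "snd a ` U = V" using V(3) by (auto simp: U_def)
  have "?F ` snd a ` U = (\<lambda>q. snd b (f q)) ` U"
    unfolding image_image by (rule image_cong) (auto simp: U_def inva)
  then have FV: "?F ` V = snd b ` f ` U" by (simp only: UV image_image)
  have fU: "f ` U = fst b \<inter> snd b -` (?F ` V)"
  proof (intro subset_antisym subsetI)
    fix y assume "y \<in> f ` U"
    then show "y \<in> fst b \<inter> snd b -` (?F ` V)" unfolding FV using Ub by blast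
  next
    fix y assume "y \<in> fst b \<inter> snd b -` (?F ` V)"
    then obtain q where q: "y \<in> fst b" "snd b y = snd b (f q)" "q \<in> U" unfolding FV by blast
    then have "y = f q" using invb Ub by metis
    then show "y \<in> f ` U" using q by blast
  qed
  have 1: "homeomorphism U V (snd a) (chart_inv a)"
    by (rule homeomorphism_of_subsets[OF complex_atlas_homeomorphism[OF A ab(1)] _ _ UV]) (use V(3) in \<open>auto simp: U_def\<close>)
  have 2: "homeomorphism (f ` U) (?F ` V) (snd b) (chart_inv b)"
    by (rule homeomorphism_of_subsets[OF complex_atlas_homeomorphism[OF A ab(2)] _ _ FV[symmetric]]) (use Ub FV in auto)
  have "homeomorphism U (f ` U) (chart_inv b \<circ> (?F \<circ> snd a)) (chart_inv a \<circ> g \<circ> snd b)"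
    using homeomorphism_compose[OF homeomorphism_compose[OF 1 V(5)] homeomorphism_symD[OF 2]] by (simp add: comp_assoc)
  then have "homeomorphism U (f ` U) f (chart_inv a \<circ> g \<circ> snd b)"
    by (rule homeomorphism_cong) (auto simp: U_def inva invb Ub)
  moreover have "open U" unfolding U_def by (rule open_chart_vimage[OF A ab(1) V(1)])
  moreover have "open (f ` U)" unfolding fU by (rule open_chart_vimage[OF A ab(2) V(4)])
  moreover have "p \<in> U" using ab V(2) by (simp add: U_def)
  ultimately show ?thesis by blast
qed

text \<open>The inverse is continuous because the space is compact and Hausdorff. In charts it is
  then a continuous right inverse of a nonsingular holomorphic map.\<close>

lemma bijective_nonsingular_biholomorphic:
  fixes A :: "('a::{t2_space, second_countable_topology}, 'n::finite) chart set"
  assumes A: "complex_atlas A" and compact: "compact (UNIV :: 'a set)"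
    and f: "holomorphic_map A A f" and bij: "bij f"
    and J: "\<And>a b p. a \<in> A \<Longrightarrow> b \<in> A \<Longrightarrow> p \<in> fst a \<Longrightarrow> f p \<in> fst b \<Longrightarrow> chart_jacobian f a b p \<noteq> 0"
  shows "biholomorphic_map A A f"
proof -
  let ?G = "inv_into UNIV f"
  have fG: "f (?G y) = y" for y using bij bij_is_surj surj_f_inv_f by metis
  have Gf: "?G (f x) = x" for x using bij bij_is_inj inv_f_f by metis
  obtain g where g: "homeomorphism UNIV UNIV f g"
    using homeomorphism_compact[OF compact holomorphic_map_continuous[OF f]] bij bij_is_surj bij_is_inj by metis
  have "g = ?G"
  proof
    fix y show "g y = ?G y" using homeomorphism_apply1[OF g UNIV_I, of "?G y"] by (simp add: fG)
  qed
  then have contG: "continuous_on UNIV ?G" using homeomorphism_cont2[OF g] by simp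
  have "holo_map_on (snd b \<circ> ?G \<circ> chart_inv a) (snd a ` (fst a \<inter> ?G -` fst b))"
    if ab: "a \<in> A" "b \<in> A" for a b
  proof (rule holo_map_on_inverse)
    note inva = chart_inv_apply[OF A ab(1)] and invb = chart_inv_apply[OF A ab(2)]
    show "holo_map_on (snd a \<circ> f \<circ> chart_inv b) (snd b ` (fst b \<inter> f -` fst a))"
      by (rule holomorphic_map_local[OF f ab(2,1)])
    show "det (jacobian (snd a \<circ> f \<circ> chart_inv b) (at x)) \<noteq> 0" if "x \<in> snd b ` (fst b \<inter> f -` fst a)" for x
      using that J[OF ab(2,1)] by (auto simp: chart_jacobian_def)
    show "open (snd a ` (fst a \<inter> ?G -` fst b))"
      by (intro open_chart_image[OF A ab(1)] open_vimage[OF complex_atlas_open[OF A ab(2)] contG])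
    show "continuous_on (snd a ` (fst a \<inter> ?G -` fst b)) (snd b \<circ> ?G \<circ> chart_inv a)"
      unfolding comp_assoc
      by (intro continuous_on_compose continuous_on_subset[OF continuous_on_chart_inv[OF A ab(1)]]
          continuous_on_subset[OF contG] continuous_on_subset[OF continuous_on_chart[OF A ab(2)]])
        (auto simp: inva)
    show "(snd b \<circ> ?G \<circ> chart_inv a) y \<in> snd b ` (fst b \<inter> f -` fst a)"
      if "y \<in> snd a ` (fst a \<inter> ?G -` fst b)" for y
      using that by (auto simp: inva fG intro!: imageI)
    show "(snd a \<circ> f \<circ> chart_inv b) ((snd b \<circ> ?G \<circ> chart_inv a) y) = y"
      if "y \<in> snd a ` (fst a \<inter> ?G -` fst b)" for y
      using that by (auto simp: inva invb fG)
  qed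
  then have "holomorphic_map A A ?G"
    using contG unfolding holomorphic_map_def case_prod_beta by simp
  then show ?thesis using bij f by (simp add: biholomorphic_map_def)
qed

theorem theorem1p5:
  fixes A :: "('a::{t2_space, second_countable_topology}, 'n::finite) chart set"
    and f :: "'a \<Rightarrow> 'a"
  assumes "calabi_yau A"
    and "holomorphic_map A A f"
    and "surj f"
  shows "biholomorphic_map A A f"
proof -
  have A: "complex_atlas A" "compact (UNIV :: 'a set)" "connected (UNIV :: 'a set)"
    and fin: "\<And>x::'a. finite (carrier (fundamental_group x))"
    using assms(1) by (simp_all add: calabi_yau_def)
  obtain m where m: "m > 0" "bundle_isomorphic A (tensor_power canonical_bundle m) trivial_bundle"
    using assms(1) unfolding calabi_yau_def by blast
  note J = chart_jacobian_nonzero[OF A m assms(2,3)]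
  have "\<exists>U g. p \<in> U \<and> open U \<and> open (f ` U) \<and> homeomorphism U (f ` U) f g" for p
  proof -
    obtain a where a: "a \<in> A" "p \<in> fst a" using complex_atlas_cover[OF A(1)] by blast
    obtain b where b: "b \<in> A" "f p \<in> fst b" using complex_atlas_cover[OF A(1)] by blast
    show ?thesis by (rule nonsingular_local_homeomorphism[OF A(1) assms(2) a(1) b(1) a(2) b(2) J[OF a(1) b(1) a(2) b(2)]])
  qed
  then have "inj f"
    by (rule inj_local_homeomorphism_finite_fundamental_group
        [OF A fin holomorphic_map_continuous[OF assms(2)] assms(3)])
  then have "bij f" using assms(3) by (rule bijI)
  then show ?thesis by (rule bijective_nonsingular_biholomorphic[OF A(1,2) assms(2) _ J])
qed

end
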